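(* Let $\mathcal{U}$ be the quantum Lie algebra with structure constants $\sigma^{kl}_{ij}$, $C^k_{ij}$ and generators $\chi_1,\dots,\chi_N$, let $(C_n(\mathcal{U}),b)$ be its bar complex, and for $n\ge 0$ let $C_{n+1}(\mathcal{U},\wedge\mathcal{L})\subset C_{n+1}(\mathcal{U})=\mathcal{U}^{\otimes (n+1)}$ be the subspace of $q$-antisymmetric chains. Then the boundary operator $b$ preserves $q$-antisymmetry: for every $n\ge 1$, $$b\bigl(C_{n+1}(\mathcal{U},\wedge\mathcal{L})\bigr)\subset C_{n}(\mathcal{U},\wedge\mathcal{L}).$$ In other words, $(C_n(\mathcal{U},\wedge\mathcal{L}),b)$ is a complex, and it is a subcomplex of the bar complex $(C_n(\mathcal{U}),b)$.
   Context: Matrix convention. Fix a ground field. A tensor $M^{k_1\dots k_m}_{i_1\dots i_n}$ is regarded as a matrix with row multi-index $(i_1,\dots,i_n)$ (lower) and column multi-index $(k_1,\dots,k_m)$ (upper); products are matrix products in this sense, $(MM')^{l}_{i}=\sum_k M^{k}_{i}M'^{l}_{k}$. Repeated indices are summed. Small indices run over $1,\dots,N$, capital ones over $0,1,\dots,N$. Quantum Lie algebra. Let $\sigma=(\sigma^{kl}_{ij})$ be an $N^2\times N^2$ matrix having eigenvalue $1$, and $C=(C^k_{ij})$ an $N^2\times N$ matrix. Define the $(N+1)^2\times(N+1)^2$ matrix $R=(R^{CD}_{AB})$ by $$R^{kl}_{ij}=\sigma^{kl}_{ij},\qquad R^{0k}_{ij}=C^k_{ij},\qquad R^{0A}_{B0}=R^{A0}_{0B}=\delta^A_B,$$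 all other components being zero. It is required that $R$ satisfies the Yang-Baxter equation $R_{\underline{1}}R_{\underline{2}}R_{\underline{1}}=R_{\underline{2}}R_{\underline{1}}R_{\underline{2}}$, where $R_{\underline{k}}$ is $R$ acting in the $k$-th and $(k+1)$-st tensor factors. The quantum Lie algebra $\mathcal{U}$ is the unital associative algebra with generators $\chi_1,\dots,\chi_N$ and relations $$\chi_i\chi_j-\sigma^{kl}_{ij}\chi_k\chi_l=C^k_{ij}\chi_k .$$ Antisymmetrizers. Let $\sigma_k$ denote $\sigma$ acting in the factors $k,k+1$. Put $A_{1\to 1}=1$ and, for $n\ge 2$, $A_{1\to n}=f_{1\to n}A_{1\to n-1}$, where $$f_{1\to n}=1-\sigma_{n-1}+\sigma_{n-2}\sigma_{n-1}-\dots+(-1)^{n-1}\sigma_1\sigma_2\cdots\sigma_{n-1}.$$ So $A_{1\to n}$ is an $N^n\times N^n$ matrix. Bar complex. $C_n(\mathcal{U})=\mathcal{U}^{\otimes n}$ for $n\ge 1$, and $b:C_{n+1}(\mathcal{U})\to C_n(\mathcal{U})$, $n\ge 1$, is $$b(a_1\otimes\dots\otimes a_{n+1})=\sum_{i=1}^{n}(-1)^{n-i}\,a_1\otimes\dots\otimes a_ia_{i+1}\otimes\dots\otimes a_{n+1}.$$ $q$-antisymmetric chains. Put $\chi_{i_1}\wedge\dots\wedge\chi_{i_n}:=(A_{1\to n})^{k_1\dots k_n}_{i_1\dots i_n}\,\chi_{k_1}\otimes\dots\otimes\chi_{k_n}\in\mathcal{U}^{\otimes n}$. Then $C_{n+1}(\mathcal{U},\wedge\mathcal{L})$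 is the linear span of all chains $a\otimes(\chi_{i_1}\wedge\dots\wedge\chi_{i_n})$ with $a\in\mathcal{U}$ and $1\le i_1,\dots,i_n\le N$ (for $n=0$ it is $\mathcal{U}$). *)

theory Defs
  imports "HOL-Analysis.Analysis" "HOL-Library.Poly_Mapping"
begin

section \<open>Free vector spaces\<close>

text \<open>The space \<open>'x \<Rightarrow>\<^sub>0 'k\<close> of finitely supported functions is the free \<open>'k\<close>-vector space on
  the type \<open>'x\<close>; the basis vector of \<open>x\<close> is \<open>Poly_Mapping.single x 1\<close>.\<close>

definition free_scale :: "'k::field \<Rightarrow> ('x \<Rightarrow>\<^sub>0 'k) \<Rightarrow> ('x \<Rightarrow>\<^sub>0 'k)" where
  "free_scale c = Poly_Mapping.map ((*) c)"

abbreviation basis_vec :: "'x \<Rightarrow> ('x \<Rightarrow>\<^sub>0 'k::field)" where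
  "basis_vec x \<equiv> Poly_Mapping.single x 1"

lemma lookup_free_scale [simp]:
  "Poly_Mapping.lookup (free_scale c p) x = c * Poly_Mapping.lookup p x"
  by (simp add: free_scale_def Poly_Mapping.map.rep_eq when_def)

global_interpretation free: vector_space free_scale
  by unfold_locales
    (auto intro!: poly_mapping_eqI simp: lookup_add algebra_simps)

definition linear_extension ::
    "('k::field \<Rightarrow> 'v::ab_group_add \<Rightarrow> 'v) \<Rightarrow> ('x \<Rightarrow> 'v) \<Rightarrow> ('x \<Rightarrow>\<^sub>0 'k) \<Rightarrow> 'v" where
  "linear_extension s f p =
     (\<Sum>x\<in>Poly_Mapping.keys p. s (Poly_Mapping.lookup p x) (f x))"

section \<open>Matrices in tensor factors\<close>

text \<open>A matrix \<open>M :: 'k^('a \<times> 'a)^('a \<times> 'a)\<close> has entries \<open>M $ (i, j) $ (k, l)\<close>, with row index the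
  lower pair and column index the upper pair, so that this entry is $M^{kl}_{ij}$.
  Matrices on \<open>n\<close> tensor factors are functions of a lower and an upper multi-index, which are lists of
  length \<open>n\<close>; they vanish if one of the lists has another length.\<close>

type_synonym ('a, 'k) multimatrix = "'a list \<Rightarrow> 'a list \<Rightarrow> 'k"

definition multi_id :: "nat \<Rightarrow> ('a, 'k::field) multimatrix" where
  "multi_id n is ks = (if length is = n \<and> is = ks then 1 else 0)"

definition multi_mult ::
    "nat \<Rightarrow> ('a::finite, 'k::field) multimatrix \<Rightarrow> ('a, 'k) multimatrix \<Rightarrow> ('a, 'k) multimatrix" where
  "multi_mult n M M' is ls = (\<Sum>ks | length ks = n. M is ks * M' ks ls)"

text \<open>\<open>in_factors n M k\<close> is \<open>M\<close> acting in the factors \<open>k\<close> and \<open>k + 1\<close> out of \<open>1, \<dots>, n\<close>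
  (for \<open>1 \<le> k < n\<close>). Lists are indexed from \<open>0\<close>, so these are the list positions \<open>k - 1\<close> and \<open>k\<close>.\<close>

definition in_factors ::
    "nat \<Rightarrow> 'k::field^('a::finite \<times> 'a)^('a \<times> 'a) \<Rightarrow> nat \<Rightarrow> ('a, 'k) multimatrix" where
  "in_factors n M k is ks =
     (if length is = n \<and> length ks = n \<and> (\<forall>p<n. p \<noteq> k - 1 \<and> p \<noteq> k \<longrightarrow> is ! p = ks ! p)
      then M $ (is ! (k - 1), is ! k) $ (ks ! (k - 1), ks ! k) else 0)"

definition yang_baxter :: "'k::field^('a::finite \<times> 'a)^('a \<times> 'a) \<Rightarrow> bool" where
  "yang_baxter R \<longleftrightarrow>
     multi_mult 3 (multi_mult 3 (in_factors 3 R 1) (in_factors 3 R 2)) (in_factors 3 R 1) =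
     multi_mult 3 (multi_mult 3 (in_factors 3 R 2) (in_factors 3 R 1)) (in_factors 3 R 2)"

text \<open>\<open>f_op n \<sigma> m\<close> and \<open>antisymmetrizer n \<sigma> m\<close> are $f_{1\to m}$ and $A_{1\to m}$ acting in the first
  \<open>m\<close> out of \<open>n\<close> factors. The \<open>j\<close>-th summand of $f_{1\to m}$ is
  $(-1)^j\sigma_{m-j}\sigma_{m-j+1}\cdots\sigma_{m-1}$.\<close>

definition f_op ::
    "nat \<Rightarrow> 'k::field^('a::finite \<times> 'a)^('a \<times> 'a) \<Rightarrow> nat \<Rightarrow> ('a, 'k) multimatrix" where
  "f_op n \<sigma> m is ks =
     (\<Sum>j<m. (-1) ^ j * foldr (multi_mult n) (map (in_factors n \<sigma>) [m - j..<m]) (multi_id n) is ks)"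

fun antisymmetrizer ::
    "nat \<Rightarrow> 'k::field^('a::finite \<times> 'a)^('a \<times> 'a) \<Rightarrow> nat \<Rightarrow> ('a, 'k) multimatrix" where
  "antisymmetrizer n \<sigma> 0 = multi_id n"
| "antisymmetrizer n \<sigma> (Suc 0) = multi_id n"
| "antisymmetrizer n \<sigma> (Suc (Suc m)) =
     multi_mult n (f_op n \<sigma> (Suc (Suc m))) (antisymmetrizer n \<sigma> (Suc m))"

section \<open>Quantum Lie algebras\<close>

text \<open>The small indices $1,\dots,N$ are the elements of a finite type \<open>'i\<close>, the capital indices
  $0,1,\dots,N$ those of \<open>'i option\<close>, where \<open>None\<close> plays the role of \<open>0\<close>.
  The structure constants $C^k_{ij}$ are \<open>C $ (i, j) $ k\<close>.\<close>

definition qla_R_entry ::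
    "'k::field^('i::finite \<times> 'i)^('i \<times> 'i) \<Rightarrow> 'k^'i^('i \<times> 'i) \<Rightarrow>
     'i option \<times> 'i option \<Rightarrow> 'i option \<times> 'i option \<Rightarrow> 'k" where
  "qla_R_entry \<sigma> C lower upper =
     (case (lower, upper) of
        ((Some i, Some j), (Some k, Some l)) \<Rightarrow> \<sigma> $ (i, j) $ (k, l)
      | ((Some i, Some j), (None, Some k)) \<Rightarrow> C $ (i, j) $ k
      | ((B, None), (None, A)) \<Rightarrow> if A = B then 1 else 0
      | ((None, B), (A, None)) \<Rightarrow> if A = B then 1 else 0
      | _ \<Rightarrow> 0)"

definition qla_R ::
    "'k::field^('i::finite \<times> 'i)^('i \<times> 'i) \<Rightarrow> 'k^'i^('i \<times> 'i) \<Rightarrow>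
     'k^('i option \<times> 'i option)^('i option \<times> 'i option)" where
  "qla_R \<sigma> C = (\<chi> lower upper. qla_R_entry \<sigma> C lower upper)"

text \<open>The words in a type form its free monoid. Through this instance the ring
  \<open>'i list \<Rightarrow>\<^sub>0 'k\<close> is the free unital associative algebra on \<open>'i\<close>.\<close>

instantiation list :: (type) monoid_add
begin

definition zero_list :: "'a list" where "0 = []"

definition plus_list :: "'a list \<Rightarrow> 'a list \<Rightarrow> 'a list" where "xs + ys = xs @ ys"

instance by standard (auto simp: zero_list_def plus_list_def)

end

definition two_sided_ideal :: "'a::ring_1 set \<Rightarrow> bool" where
  "two_sided_ideal I \<longleftrightarrow>
     0 \<in> I \<and> (\<forall>x\<in>I. \<forall>y\<in>I. x + y \<in> I) \<and> (\<forall>x\<in>I. \<forall>r. r * x \<in> I \<and> x * r \<in> I)"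

definition qla_relators ::
    "'k::field^('i::finite \<times> 'i)^('i \<times> 'i) \<Rightarrow> 'k^'i^('i \<times> 'i) \<Rightarrow> ('i list \<Rightarrow>\<^sub>0 'k) set" where
  "qla_relators \<sigma> C =
     {basis_vec [i, j]
      - (\<Sum>k\<in>UNIV. \<Sum>l\<in>UNIV. free_scale (\<sigma> $ (i, j) $ (k, l)) (basis_vec [k, l]))
      - (\<Sum>k\<in>UNIV. free_scale (C $ (i, j) $ k) (basis_vec [k])) | i j. True}"

locale k_algebra = vector_space scal
  for scal :: "'k::field \<Rightarrow> 'u::ring_1 \<Rightarrow> 'u" +
  assumes scale_mult_left: "scal c x * y = scal c (x * y)"
    and scale_mult_right: "x * scal c y = scal c (x * y)"

text \<open>The algebra given by the generators and relations is determined up to isomorphism by the last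
  two assumptions: evaluation of noncommutative polynomials at the generators \<open>gen\<close> is onto, and its
  kernel is the two-sided ideal generated by the relators. That \<open>'u :: ring_1\<close> satisfies \<open>0 \<noteq> 1\<close> is
  no restriction, since the relators have no constant term.\<close>

locale quantum_lie_algebra = k_algebra scal
  for scal :: "'k::field \<Rightarrow> 'u::ring_1 \<Rightarrow> 'u" +
  fixes \<sigma> :: "'k^('i::finite \<times> 'i)^('i \<times> 'i)"
    and C :: "'k^'i^('i \<times> 'i)"
    and gen :: "'i \<Rightarrow> 'u"
  assumes eigenvalue_one: "\<exists>v. v \<noteq> 0 \<and> \<sigma> *v v = v"
    and yang_baxter_R: "yang_baxter (qla_R \<sigma> C)"
    and generated: "range (linear_extension scal (\<lambda>w. prod_list (map gen w))) = UNIV"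
    and presented: "{p. linear_extension scal (\<lambda>w. prod_list (map gen w)) p = 0} =
      two_sided_ideal hull qla_relators \<sigma> C"

section \<open>Tensor powers\<close>

text \<open>The tensor powers of a vector space \<open>'u\<close> are constructed together, as the quotient of the free
  vector space on the lists over \<open>'u\<close> by the relations of multilinearity. Tensors are the cosets;
  $x_1\otimes\dots\otimes x_n$ is the coset of \<open>basis_vec [x\<^sub>1, \<dots>, x\<^sub>n]\<close>. The relations are
  homogeneous in the length of lists, so the cosets of combinations of lists of length \<open>n\<close> form the
  \<open>n\<close>-th tensor power.\<close>

type_synonym ('u, 'k) tensor = "('u list \<Rightarrow>\<^sub>0 'k) set"

definition multilinear_relators ::
    "('k::field \<Rightarrow> 'u::ab_group_add \<Rightarrow> 'u) \<Rightarrow> ('u list \<Rightarrow>\<^sub>0 'k) set" where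
  "multilinear_relators scal =
     {basis_vec (xs @ [x + y] @ ys) - basis_vec (xs @ [x] @ ys) - basis_vec (xs @ [y] @ ys)
        | xs x y ys. True} \<union>
     {basis_vec (xs @ [scal c x] @ ys) - free_scale c (basis_vec (xs @ [x] @ ys))
        | xs c x ys. True}"

definition tensor_coset ::
    "('k::field \<Rightarrow> 'u::ab_group_add \<Rightarrow> 'u) \<Rightarrow> ('u list \<Rightarrow>\<^sub>0 'k) \<Rightarrow> ('u, 'k) tensor" where
  "tensor_coset scal v = {w. w - v \<in> free.span (multilinear_relators scal)}"

definition tensor_add ::
    "('k::field \<Rightarrow> 'u::ab_group_add \<Rightarrow> 'u) \<Rightarrow> ('u, 'k) tensor \<Rightarrow> ('u, 'k) tensor \<Rightarrow> ('u, 'k) tensor" where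
  "tensor_add scal X Y = (\<Union>x\<in>X. \<Union>y\<in>Y. tensor_coset scal (x + y))"

definition tensor_scale ::
    "('k::field \<Rightarrow> 'u::ab_group_add \<Rightarrow> 'u) \<Rightarrow> 'k \<Rightarrow> ('u, 'k) tensor \<Rightarrow> ('u, 'k) tensor" where
  "tensor_scale scal c X = (\<Union>x\<in>X. tensor_coset scal (free_scale c x))"

definition tensor_subspace ::
    "('k::field \<Rightarrow> 'u::ab_group_add \<Rightarrow> 'u) \<Rightarrow> ('u, 'k) tensor set \<Rightarrow> bool" where
  "tensor_subspace scal S \<longleftrightarrow>
     S \<subseteq> range (tensor_coset scal) \<and>
     tensor_coset scal 0 \<in> S \<and>
     (\<forall>X\<in>S. \<forall>Y\<in>S. tensor_add scal X Y \<in> S) \<and>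
     (\<forall>c. \<forall>X\<in>S. tensor_scale scal c X \<in> S)"

definition tensor_span ::
    "('k::field \<Rightarrow> 'u::ab_group_add \<Rightarrow> 'u) \<Rightarrow> ('u, 'k) tensor set \<Rightarrow> ('u, 'k) tensor set" where
  "tensor_span scal S = tensor_subspace scal hull S"

definition tensor_power ::
    "('k::field \<Rightarrow> 'u::ab_group_add \<Rightarrow> 'u) \<Rightarrow> nat \<Rightarrow> ('u, 'k) tensor set" where
  "tensor_power scal n =
     tensor_coset scal ` {v. \<forall>xs\<in>Poly_Mapping.keys v. length xs = n}"

section \<open>Complexes\<close>

text \<open>Complexes start in degree \<open>1\<close>; the members of the families below in degree \<open>0\<close> are irrelevant.\<close>

definition is_chain_complex ::
    "('k::field \<Rightarrow> 'u::ab_group_add \<Rightarrow> 'u) \<Rightarrow> (nat \<Rightarrow> ('u, 'k) tensor set) \<Rightarrow>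
     (('u, 'k) tensor \<Rightarrow> ('u, 'k) tensor) \<Rightarrow> bool" where
  "is_chain_complex scal K b \<longleftrightarrow>
     (\<forall>n\<ge>1. tensor_subspace scal (K n)) \<and>
     (\<forall>n\<ge>1. b ` K (n + 1) \<subseteq> K n) \<and>
     (\<forall>n\<ge>1. \<forall>X\<in>K (n + 1). \<forall>Y\<in>K (n + 1). b (tensor_add scal X Y) = tensor_add scal (b X) (b Y)) \<and>
     (\<forall>n\<ge>1. \<forall>X\<in>K (n + 1). \<forall>c. b (tensor_scale scal c X) = tensor_scale scal c (b X)) \<and>
     (\<forall>n\<ge>1. \<forall>X\<in>K (n + 2). b (b X) = tensor_coset scal 0)"

definition is_subcomplex ::
    "('k::field \<Rightarrow> 'u::ab_group_add \<Rightarrow> 'u) \<Rightarrow> (nat \<Rightarrow> ('u, 'k) tensor set) \<Rightarrow>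
     (nat \<Rightarrow> ('u, 'k) tensor set) \<Rightarrow> (('u, 'k) tensor \<Rightarrow> ('u, 'k) tensor) \<Rightarrow> bool" where
  "is_subcomplex scal K L b \<longleftrightarrow>
     is_chain_complex scal K b \<and> is_chain_complex scal L b \<and> (\<forall>n\<ge>1. K n \<subseteq> L n)"

text \<open>\<open>mult_at i [a\<^sub>1, \<dots>, a\<^sub>n\<^sub>+\<^sub>1] = [a\<^sub>1, \<dots>, a\<^sub>i a\<^sub>i\<^sub>+\<^sub>1, \<dots>, a\<^sub>n\<^sub>+\<^sub>1]\<close> for \<open>1 \<le> i \<le> n\<close>.\<close>

definition mult_at :: "nat \<Rightarrow> 'u::times list \<Rightarrow> 'u list" where
  "mult_at i as = take (i - 1) as @ [as ! (i - 1) * as ! i] @ drop (i + 1) as"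

definition bar_boundary_basis :: "'u::ring_1 list \<Rightarrow> ('u list \<Rightarrow>\<^sub>0 'k::field)" where
  "bar_boundary_basis as =
     (let n = length as - 1 in \<Sum>i=1..n. free_scale ((-1) ^ (n - i)) (basis_vec (mult_at i as)))"

definition bar_boundary ::
    "('k::field \<Rightarrow> 'u::ring_1 \<Rightarrow> 'u) \<Rightarrow> ('u, 'k) tensor \<Rightarrow> ('u, 'k) tensor" where
  "bar_boundary scal X =
     (\<Union>x\<in>X. tensor_coset scal (linear_extension free_scale bar_boundary_basis x))"

text \<open>The boundary does not depend on the choice of a representative.\<close>

lemma linear_extension_superset:
  assumes "finite A" "Poly_Mapping.keys p \<subseteq> A"
  shows "linear_extension free_scale f p = (\<Sum>x\<in>A. free_scale (Poly_Mapping.lookup p x) (f x))"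
  unfolding linear_extension_def
  by (rule sum.mono_neutral_left) (use assms in \<open>auto simp: in_keys_iff\<close>)

lemma module_hom_linear_extension:
  fixes f :: "'x \<Rightarrow> ('y \<Rightarrow>\<^sub>0 'k::field)"
  shows "module_hom free_scale free_scale (linear_extension free_scale f)"
proof unfold_locales
  fix p q :: "'x \<Rightarrow>\<^sub>0 'k"
  let ?A = "Poly_Mapping.keys p \<union> Poly_Mapping.keys q"
  have "Poly_Mapping.keys (p + q) \<subseteq> ?A" by (rule Poly_Mapping.keys_add)
  then show "linear_extension free_scale f (p + q) =
      linear_extension free_scale f p + linear_extension free_scale f q"
    by (simp add: linear_extension_superset[of ?A] lookup_add free.scale_left_distrib sum.distrib)
next
  fix c and p :: "'x \<Rightarrow>\<^sub>0 'k"
  have "Poly_Mapping.keys (free_scale c p) \<subseteq> Poly_Mapping.keys p" by (auto simp: in_keys_iff)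
  then show "linear_extension free_scale f (free_scale c p) =
      free_scale c (linear_extension free_scale f p)"
    by (simp add: linear_extension_superset[of "Poly_Mapping.keys p"] free.scale_sum_right)
qed

lemma linear_extension_basis_vec [simp]:
  "linear_extension free_scale f (basis_vec x) = f x"
  by (simp add: linear_extension_def)

lemma tensor_coset_eq_iff:
  "tensor_coset scal v = tensor_coset scal w \<longleftrightarrow> v - w \<in> free.span (multilinear_relators scal)"
proof
  assume "tensor_coset scal v = tensor_coset scal w"
  moreover have "v \<in> tensor_coset scal v" by (simp add: tensor_coset_def free.span_zero)
  ultimately show "v - w \<in> free.span (multilinear_relators scal)" by (auto simp: tensor_coset_def)
next
  assume *: "v - w \<in> free.span (multilinear_relators scal)"
  have "u - v \<in> free.span (multilinear_relators scal) \<longleftrightarrow> u - w \<in> free.span (multilinear_relators scal)" for u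
    using free.span_add[OF _ *, of "u - v"] free.span_diff[OF _ *, of "u - w"] by auto
  then show "tensor_coset scal v = tensor_coset scal w" by (simp add: tensor_coset_def)
qed

context k_algebra
begin

lemma mult_at_slot:
  assumes "1 \<le> i" "i \<le> length xs + length ys"
  obtains us h vs where "\<And>z. mult_at i (xs @ [z] @ ys) = us @ [h z] @ vs"
    "\<And>x y. h (x + y) = h x + h y" "\<And>c x. h (scal c x) = scal c (h x)"
proof -
  consider "i < length xs" | "i = length xs" | "i = length xs + 1" | "i > length xs + 1" by linarith
  then show thesis
  proof cases
    case 1
    show ?thesis
      by (rule that[of "mult_at i xs" id ys]) (use 1 assms in \<open>auto simp: mult_at_def nth_append\<close>)
  next
    case 2
    show ?thesis
      by (rule that[of "take (i - 1) xs" "\<lambda>z. xs ! (i - 1) * z" ys])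
        (use 2 assms in \<open>auto simp: mult_at_def nth_append distrib_left scale_mult_right\<close>)
  next
    case 3
    show ?thesis
      by (rule that[of xs "\<lambda>z. z * ys ! 0" "drop 1 ys"])
        (use 3 assms in \<open>auto simp: mult_at_def nth_append distrib_right scale_mult_left\<close>)
  next
    case 4
    then obtain k where k: "i = length xs + 2 + k" by (metis add_2_eq_Suc' add_Suc_shift less_iff_Suc_add add.commute plus_1_eq_Suc add_Suc)
    show ?thesis
      by (rule that[of xs id "mult_at (k + 1) ys"])
        (use k assms in \<open>auto simp: mult_at_def nth_append numeral_3_eq_3\<close>)
  qed
qed

lemma bar_boundary_basis_alt:
  "bar_boundary_basis (xs @ [z] @ ys) =
     (\<Sum>i=1..length xs + length ys. free_scale ((-1) ^ (length xs + length ys - i)) (basis_vec (mult_at i (xs @ [z] @ ys))))"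
  by (simp add: bar_boundary_basis_def Let_def)

lemma bar_boundary_relators:
  assumes "r \<in> multilinear_relators scal"
  shows "linear_extension free_scale bar_boundary_basis r \<in> free.span (multilinear_relators scal)"
proof -
  interpret L: module_hom free_scale free_scale "linear_extension free_scale bar_boundary_basis"
    by (rule module_hom_linear_extension)
  from assms consider
      (add) xs x y ys where "r = basis_vec (xs @ [x + y] @ ys) - basis_vec (xs @ [x] @ ys) - basis_vec (xs @ [y] @ ys)"
    | (scale) xs c x ys where "r = basis_vec (xs @ [scal c x] @ ys) - free_scale c (basis_vec (xs @ [x] @ ys))"
    unfolding multilinear_relators_def by blast
  then show ?thesis
  proof cases
    case add
    show ?thesis
      unfolding add L.diff linear_extension_basis_vec bar_boundary_basis_alt
        sum_subtractf[symmetric] free.scale_right_diff_distrib[symmetric]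
    proof (intro free.span_sum free.span_scale free.span_base)
      fix i assume "i \<in> {1..length xs + length ys}"
      then obtain us h vs where "\<And>z. mult_at i (xs @ [z] @ ys) = us @ [h z] @ vs"
        "\<And>x y. h (x + y) = h x + h y"
        using mult_at_slot[of i xs ys] by (metis atLeastAtMost_iff)
      then show "basis_vec (mult_at i (xs @ [x + y] @ ys)) - basis_vec (mult_at i (xs @ [x] @ ys)) -
          basis_vec (mult_at i (xs @ [y] @ ys)) \<in> multilinear_relators scal"
        unfolding multilinear_relators_def by auto
    qed
  next
    case scale
    have "linear_extension free_scale bar_boundary_basis r =
      (\<Sum>i=1..length xs + length ys. free_scale ((-1) ^ (length xs + length ys - i))
        (basis_vec (mult_at i (xs @ [scal c x] @ ys)) - free_scale c (basis_vec (mult_at i (xs @ [x] @ ys)))))"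
      unfolding scale L.diff L.scale linear_extension_basis_vec bar_boundary_basis_alt
      by (simp add: free.scale_sum_right sum_subtractf free.scale_right_diff_distrib mult.commute)
    also have "\<dots> \<in> free.span (multilinear_relators scal)"
    proof (intro free.span_sum free.span_scale free.span_base)
      fix i assume "i \<in> {1..length xs + length ys}"
      then obtain us h vs where "\<And>z. mult_at i (xs @ [z] @ ys) = us @ [h z] @ vs"
        "\<And>c x. h (scal c x) = scal c (h x)"
        using mult_at_slot[of i xs ys] by (metis atLeastAtMost_iff)
      then show "basis_vec (mult_at i (xs @ [scal c x] @ ys)) - free_scale c (basis_vec (mult_at i (xs @ [x] @ ys)))
           \<in> multilinear_relators scal"
        unfolding multilinear_relators_def by (simp only:) blast
    qed
    finally show ?thesis .
  qed
qed

lemma bar_boundary_tensor_coset: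
  "bar_boundary scal (tensor_coset scal v) =
     tensor_coset scal (linear_extension free_scale bar_boundary_basis v)"
proof -
  interpret L: module_hom free_scale free_scale "linear_extension free_scale bar_boundary_basis"
    by (rule module_hom_linear_extension)
  let ?L = "linear_extension free_scale bar_boundary_basis" and ?W = "free.span (multilinear_relators scal)"
  have "?L ` ?W \<subseteq> ?W"
    unfolding L.span_image[symmetric]
    by (rule free.span_minimal) (auto intro: bar_boundary_relators free.subspace_span)
  then have "tensor_coset scal (?L w) = tensor_coset scal (?L v)" if "w \<in> tensor_coset scal v" for w
    using that unfolding tensor_coset_eq_iff L.diff[symmetric] by (auto simp: tensor_coset_def)
  moreover have "v \<in> tensor_coset scal v" by (simp add: tensor_coset_def free.span_zero)
  ultimately show ?thesis unfolding bar_boundary_def by blast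
qed

end

text \<open>The coset of \<open>antisym_rep \<sigma> gen a is\<close> is $a\otimes(\chi_{i_1}\wedge\dots\wedge\chi_{i_n})
  = A^{k_1\dots k_n}_{i_1\dots i_n}\, a\otimes\chi_{k_1}\otimes\dots\otimes\chi_{k_n}$, where
  \<open>is = [i\<^sub>1, \<dots>, i\<^sub>n]\<close>.\<close>

definition antisym_rep ::
    "'k::field^('i::finite \<times> 'i)^('i \<times> 'i) \<Rightarrow> ('i \<Rightarrow> 'u) \<Rightarrow> 'u \<Rightarrow> 'i list \<Rightarrow> ('u list \<Rightarrow>\<^sub>0 'k)" where
  "antisym_rep \<sigma> gen a is =
     (let n = length is in
      \<Sum>ks | length ks = n. free_scale (antisymmetrizer n \<sigma> n is ks) (basis_vec (a # map gen ks)))"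

definition antisym_chains ::
    "('k::field \<Rightarrow> 'u::ring_1 \<Rightarrow> 'u) \<Rightarrow> 'k^('i::finite \<times> 'i)^('i \<times> 'i) \<Rightarrow> ('i \<Rightarrow> 'u) \<Rightarrow>
     nat \<Rightarrow> ('u, 'k) tensor set" where
  "antisym_chains scal \<sigma> gen m =
     tensor_span scal {tensor_coset scal (antisym_rep \<sigma> gen a is) | a is. length is + 1 = m}"

end

theory Submission
  imports Defs
begin

text \<open>Adjoin $\chi_0=1$, so that the defining relations become $\chi_A\chi_B=R^{CD}_{AB}\chi_C\chi_D$,
  and let $\hat A$ be the antisymmetrizer of $R$. The braid relations give factorizations
  $\hat A_{1\to n}=B_k(1-R_k)$ for every $k$ and $\hat A_{1\to n}=G\,\hat A_{2\to n}$. Take lower indices different from $0$.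
  Then the entries of $\hat A$ without an upper index $0$ are those of $A$; write $D_p$ for those whose
  only upper $0$ is at place $p$. By the first factorization, multiplying the factors $k$ and $k+1$ of
  $\hat A^{K_1\dots K_n}\chi_{K_1}\otimes\dots\otimes\chi_{K_n}$ gives $0$, hence multiplying the
  factors $k$ and $k+1$ of $\chi_{i_1}\wedge\dots\wedge\chi_{i_n}$ gives $-(D_k+D_{k+1})$, contracted
  with $n-1$ generators. The alternating sum over $k$ telescopes to $D_1$, because $D_n=0$. Together
  with the summand $a\chi_{k_1}\otimes\chi_{k_2}\otimes\dots$ of the boundary this is a sum over a
  first upper index $0,\dots,N$ of $\hat A$, and the second factorization exhibits it as antisymmetric.\<close>

section \<open>Antisymmetrizers in a ring with braid relations\<close>

text \<open>The recursion builds A_{1..n} by multiplication on the left, whereas the generators are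
  contracted with the upper indices, on the right. So right factors have to be extracted from the
  braid relations; both factorizations mirror coset decompositions of the symmetric group. The
  contraction at k and k+1 also meets multi-indices with a 0 at another place, or with 0 at both k
  and k+1. They are sent to zero. The relations survive this truncation, since R_k leaves the other
  places alone and R^{00}_{AB} is nonzero only for A = B = 0. What remains has no 0, or a single 0
  at k or at k+1; there the 1 is absorbed by its neighbour, and both positions give the same tensor.
  This is the origin of D_k + D_{k+1}. The two ends of the telescope differ because R is not
  symmetric: C puts its 0 on the left upper place, and an upper 0 on the right place forces a lower
  0 on the left one. Hence no 0 can arise at the last place, while D_1 remains and fits in as the
  summand with a multiplied by 1.\<close>

definition braided :: "(nat \<Rightarrow> 'r::ring_1) \<Rightarrow> bool" where
  "braided r \<longleftrightarrow> (\<forall>k. r k * r (Suc k) * r k = r (Suc k) * r k * r (Suc k)) \<and>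
     (\<forall>i j. Suc i < j \<longrightarrow> r i * r j = r j * r i)"

text \<open>Positions are counted from \<open>0\<close>, so \<open>f_elem r n\<close> and \<open>antisym_elem r n\<close> stand for
  $f_{1\to n+1}$ and $A_{1\to n+1}$.\<close>

fun f_elem :: "(nat \<Rightarrow> 'r::ring_1) \<Rightarrow> nat \<Rightarrow> 'r" where
  "f_elem r 0 = 1"
| "f_elem r (Suc n) = 1 - f_elem r n * r n"

fun antisym_elem :: "(nat \<Rightarrow> 'r::ring_1) \<Rightarrow> nat \<Rightarrow> 'r" where
  "antisym_elem r 0 = 1"
| "antisym_elem r (Suc n) = f_elem r (Suc n) * antisym_elem r n"

text \<open>Mirror image of \<open>f_elem\<close>: the sum 1 - r_0 + r_1 r_0 - ... with longest word
  r_{n-1} ... r_1 r_0. It is the factor G that remains when the antisymmetrizer of all factors but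
  the first is split off on the right.\<close>

fun g_elem :: "(nat \<Rightarrow> 'r::ring_1) \<Rightarrow> nat \<Rightarrow> 'r" where
  "g_elem r 0 = 1"
| "g_elem r (Suc n) = 1 - g_elem (\<lambda>k. r (Suc k)) n * r 0"

text \<open>Up to sign the longest summand of \<open>f_elem r n\<close>. Moving it past a generator
  raises the index of that generator by one.\<close>

fun coxeter :: "(nat \<Rightarrow> 'r::ring_1) \<Rightarrow> nat \<Rightarrow> 'r" where
  "coxeter r 0 = 1"
| "coxeter r (Suc n) = coxeter r n * r n"

lemma braided_shift: "braided r \<Longrightarrow> braided (\<lambda>k. r (Suc k))"
  unfolding braided_def by (metis Suc_less_eq)

lemma braidedD:
  assumes "braided r"
  shows "r k * r (Suc k) * r k = r (Suc k) * r k * r (Suc k)"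
    and "Suc i < j \<Longrightarrow> r i * r j = r j * r i"
  using assms unfolding braided_def by blast+

section \<open>Commutation rules and the left factorization\<close>

lemma f_elem_commute:
  assumes "\<And>k. k < n \<Longrightarrow> x * r k = r k * x"
  shows "x * f_elem r n = f_elem r n * x"
  using assms
proof (induction n)
  case (Suc n)
  have "x * (f_elem r n * r n) = f_elem r n * (x * r n)"
    using Suc by (metis mult.assoc less_SucI)
  also have "\<dots> = f_elem r n * r n * x" using Suc.prems by (simp add: mult.assoc)
  finally show ?case by (simp add: algebra_simps)
qed simp

lemma antisym_commute:
  assumes "\<And>k. k < n \<Longrightarrow> x * r k = r k * x"
  shows "x * antisym_elem r n = antisym_elem r n * x"
  using assms
proof (induction n)
  case (Suc n)
  have "x * f_elem r (Suc n) = f_elem r (Suc n) * x"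
    using Suc.prems by (rule f_elem_commute)
  moreover have "x * antisym_elem r n = antisym_elem r n * x" using Suc by simp
  ultimately show ?case
    by (simp only: antisym_elem.simps mult.assoc[symmetric]) (simp only: mult.assoc)
qed simp

text \<open>The summands are words of consecutive generators ending in \<open>r n\<close>, together
  with 1; only the longest word reaches down to \<open>r 0\<close>, and the others make up the
  shifted \<open>f_elem\<close>.\<close>

lemma f_elem_conv_shift:
  "f_elem r (Suc n) = f_elem (\<lambda>k. r (Suc k)) n + (-1) ^ Suc n * coxeter r (Suc n)"
proof (induction n)
  case (Suc n)
  have "f_elem r (Suc (Suc n)) = 1 - f_elem r (Suc n) * r (Suc n)" by simp
  also have "\<dots> = 1 - (f_elem (\<lambda>k. r (Suc k)) n + (-1) ^ Suc n * coxeter r (Suc n)) * r (Suc n)"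
    by (simp only: Suc.IH)
  also have "\<dots> = f_elem (\<lambda>k. r (Suc k)) (Suc n) + (-1) ^ Suc (Suc n) * coxeter r (Suc (Suc n))"
    by (simp add: algebra_simps)
  finally show ?case .
qed simp

lemma coxeter_conv_shift: "coxeter r (Suc n) = r 0 * coxeter (\<lambda>k. r (Suc k)) n"
  by (induction n) (simp_all add: mult.assoc)

lemma coxeter_commute:
  assumes "\<And>k. k < n \<Longrightarrow> x * r k = r k * x"
  shows "x * coxeter r n = coxeter r n * x"
  using assms
proof (induction n)
  case (Suc n)
  have "x * (coxeter r n * r n) = coxeter r n * (x * r n)"
    using Suc by (metis mult.assoc less_SucI)
  also have "\<dots> = coxeter r n * r n * x" using Suc.prems by (simp add: mult.assoc)
  finally show ?case by simp
qed simp

text \<open>Coming from the right, \<open>r j\<close> commutes with everything down to r_{j+2},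
  turns r_j r_{j+1} r_j into r_{j+1} r_j r_{j+1}, and the new r_{j+1} commutes with r_0, ...,
  r_{j-1}.\<close>

lemma coxeter_step:
  assumes "braided r" "Suc j < n"
  shows "coxeter r n * r j = r (Suc j) * coxeter r n"
  using assms(2)
proof (induction n)
  case (Suc n)
  note b = braidedD[OF assms(1)]
  show ?case
  proof (cases "Suc j = n")
    case True
    have c: "r n * coxeter r j = coxeter r j * r n"
      using True by (intro coxeter_commute b(2)[symmetric]) auto
    have "coxeter r (Suc n) * r j = coxeter r j * (r j * r n * r j)"
      unfolding True[symmetric] by (simp add: mult.assoc)
    also have "r j * r n * r j = r n * r j * r n" using b(1)[of j] True by simp
    also have "coxeter r j * (r n * r j * r n) = r n * (coxeter r j * r j * r n)"
      using c by (metis mult.assoc)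
    also have "\<dots> = r n * coxeter r (Suc n)" unfolding True[symmetric] by simp
    finally show ?thesis using True by simp
  next
    case False
    then have j: "Suc j < n" using Suc.prems by simp
    have "coxeter r (Suc n) * r j = coxeter r n * (r j * r n)"
      using b(2)[OF j] by (simp add: mult.assoc)
    also have "\<dots> = r (Suc j) * coxeter r (Suc n)"
      using Suc.IH[OF j] by (simp add: mult.assoc[symmetric])
    finally show ?thesis .
  qed
qed simp

text \<open>The offset \<open>i\<close> is there for the induction, because the recursion of
  \<open>g_elem\<close> shifts the generators; \<open>m + i < n\<close> keeps all indices within
  reach of \<open>coxeter_step\<close>.\<close>

lemma coxeter_mult_g_elem:
  assumes "braided r" "m + i < n"
  shows "coxeter r n * g_elem (\<lambda>k. r (k + i)) m = g_elem (\<lambda>k. r (k + Suc i)) m * coxeter r n"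
  using assms(2)
proof (induction m arbitrary: i)
  case (Suc m)
  have "coxeter r n * (g_elem (\<lambda>k. r (k + Suc i)) m * r i) =
      g_elem (\<lambda>k. r (k + Suc (Suc i))) m * (coxeter r n * r i)"
    using Suc.IH[of "Suc i"] Suc.prems by (simp add: mult.assoc[symmetric])
  also have "\<dots> = g_elem (\<lambda>k. r (k + Suc (Suc i))) m * r (Suc i) * coxeter r n"
    using coxeter_step[OF assms(1), of i n] Suc.prems by (simp add: mult.assoc)
  finally show ?case by (simp add: algebra_simps)
qed simp

text \<open>The induction step of the left factorization: a new factor \<open>f_elem\<close> must
  pass the \<open>g_elem\<close> already split off, and comes out in the shifted form that extends
  the shifted antisymmetrizer. All words involving \<open>r 0\<close> in the leading
  \<open>f_elem\<close> sit in the one term \<open>P\<close>, which \<open>coxeter_step\<close>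
  controls.\<close>

lemma f_elem_mult_g_elem:
  assumes "braided r"
  shows "f_elem r (Suc n) * g_elem r n = g_elem r (Suc n) * f_elem (\<lambda>k. r (Suc k)) n"
  using assms
proof (induction n arbitrary: r)
  case (Suc n)
  let ?s = "\<lambda>k. r (Suc k)" and ?t = "\<lambda>k. r (Suc (Suc k))"
  define f' f'' g' g'' P e where defs: "f' = f_elem ?s (Suc n)" "f'' = f_elem ?t n"
    "g' = g_elem ?s (Suc n)" "g'' = g_elem ?t n" "P = coxeter r (Suc (Suc n))" "e = (-1::'a) ^ n"
  have IH: "f' * g_elem ?s n = g' * f''"
    unfolding defs using Suc.IH[OF braided_shift[OF Suc.prems]] by simp
  have g': "g' = 1 - g'' * r 1" by (simp add: defs)
  have f: "f_elem r (Suc (Suc n)) = f' + e * P"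
    unfolding defs f_elem_conv_shift[of r] by simp
  have e: "e * x = x * e" for x :: 'a
    unfolding defs by (cases "even n") auto
  have com: "r 0 * f'' = f'' * r 0"
    unfolding defs by (rule f_elem_commute) (auto intro: braidedD(2)[OF Suc.prems])
  \<comment> \<open>\<open>f''\<close> and \<open>f'\<close> differ by a signed Coxeter product in
    the shifted generators; \<open>r 0\<close> on its left completes it to \<open>P\<close>.\<close>
  have f'': "r 0 * f'' = r 0 * f' + e * P"
  proof -
    have "f' = f'' - e * coxeter ?s (Suc n)"
      unfolding defs f_elem_conv_shift[of ?s] by simp
    then have "f'' = f' + e * coxeter ?s (Suc n)" by (simp only: diff_add_cancel)
    then have "r 0 * f'' = r 0 * f' + r 0 * e * coxeter ?s (Suc n)"
      by (simp only: distrib_left mult.assoc)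
    also have "r 0 * e * coxeter ?s (Suc n) = e * P"
      unfolding defs(5) coxeter_conv_shift[of r] e[symmetric] by (simp add: mult.assoc)
    finally show ?thesis .
  qed
  have P: "P * (g_elem ?s n * r 0) = g'' * (r 1 * P)"
  proof -
    have "P * g_elem ?s n = g'' * P"
      unfolding defs using coxeter_mult_g_elem[OF Suc.prems, of n 1 "Suc (Suc n)"] by simp
    moreover have "P * r 0 = r 1 * P"
      unfolding defs using coxeter_step[OF Suc.prems, of 0 "Suc (Suc n)"] by simp
    ultimately show ?thesis by (metis mult.assoc)
  qed
  have "f_elem r (Suc (Suc n)) * g_elem r (Suc n) = (f' + e * P) * (1 - g_elem ?s n * r 0)"
    unfolding f by simp
  also have "\<dots> = f' + e * P - (f' * g_elem ?s n) * r 0 - e * (P * (g_elem ?s n * r 0))"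
    by (simp add: algebra_simps)
  also have "\<dots> = f' + e * P - g' * (r 0 * f'') - e * (g'' * (r 1 * P))"
    unfolding IH P com by (simp add: mult.assoc)
  also have "\<dots> = f' - g' * r 0 * f' + (e * P - g' * (e * P) - e * (g'' * (r 1 * P)))"
    unfolding f'' by (simp add: algebra_simps)
  \<comment> \<open>All terms with \<open>P\<close> cancel because \<open>g' = 1 - g'' * r 1\<close>
    and the sign \<open>e\<close> is central.\<close>
  also have "e * P - g' * (e * P) - e * (g'' * (r 1 * P)) = 0"
  proof -
    have "g' * (e * P) = e * (g' * P)" using e[of g'] by (metis mult.assoc)
    then show ?thesis unfolding g' by (simp add: algebra_simps)
  qed
  finally show ?case by (simp add: defs algebra_simps)
qed simp

lemma antisym_left_factor:
  assumes "braided r"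
  shows "antisym_elem r (Suc n) = g_elem r (Suc n) * antisym_elem (\<lambda>k. r (Suc k)) n"
proof (induction n)
  case (Suc n)
  have "antisym_elem r (Suc (Suc n)) = f_elem r (Suc (Suc n)) * g_elem r (Suc n) * antisym_elem (\<lambda>k. r (Suc k)) n"
    using Suc by (metis antisym_elem.simps(2) mult.assoc)
  then show ?case
    unfolding f_elem_mult_g_elem[OF assms] by (simp only: mult.assoc antisym_elem.simps)
qed simp

text \<open>Expanding the left factor once leaves a multiple of 1 - r_{n+1} and a term to which the
  induction hypothesis applies. In it (1 - r_n) r_{n+1} r_n = r_{n+1} r_n (1 - r_{n+1}) by the braid
  relation, so the divisor moves up by one.\<close>

lemma f_elem_mult_f_elem:
  assumes "braided r"
  shows "\<exists>y. f_elem r (Suc n) * f_elem r n = y * (1 - r n)"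
proof (induction n)
  case (Suc n)
  let ?f = "f_elem r (Suc n)"
  from Suc obtain y where y: "?f * f_elem r n = y * (1 - r n)" by blast
  have com: "r (Suc n) * f_elem r n = f_elem r n * r (Suc n)"
    by (rule f_elem_commute, rule braidedD(2)[OF assms, symmetric]) simp
  have "f_elem r (Suc (Suc n)) * ?f = ?f - ?f * (r (Suc n) * ?f)"
    by (simp only: f_elem.simps(2)[of r "Suc n"] left_diff_distrib mult_1_left mult.assoc)
  also have "r (Suc n) * ?f = r (Suc n) - f_elem r n * (r (Suc n) * r n)"
    using com by (simp add: right_diff_distrib mult.assoc[symmetric])
  also have "?f - ?f * (r (Suc n) - f_elem r n * (r (Suc n) * r n)) =
      ?f * (1 - r (Suc n)) + (?f * f_elem r n) * (r (Suc n) * r n)"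
    by (simp only: algebra_simps mult_1_right)
  also have "(?f * f_elem r n) * (r (Suc n) * r n) =
      y * (r (Suc n) * r n - r n * r (Suc n) * r n)"
    unfolding y by (simp add: algebra_simps)
  also have "\<dots> = y * (r (Suc n) * r n) * (1 - r (Suc n))"
    unfolding braidedD(1)[OF assms] by (simp add: algebra_simps)
  finally have "f_elem r (Suc (Suc n)) * ?f = (?f + y * (r (Suc n) * r n)) * (1 - r (Suc n))"
    by (simp only: distrib_right)
  then show ?case by blast
qed (auto intro: exI[of _ 1])

text \<open>For k below the last position the right factor is inherited, as the recursion only
  multiplies on the left. The last one comes from two consecutive \<open>f_elem\<close>; the
  antisymmetrizer behind them is short enough to commute with \<open>r n\<close>.\<close>

lemma antisym_right_factor:
  assumes "braided r" "k < n"
  shows "\<exists>y. antisym_elem r n = y * (1 - r k)"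
  using assms(2)
proof (induction n)
  case (Suc n)
  show ?case
  proof (cases "k = n")
    case True
    show ?thesis
    proof (cases n)
      case 0
      then show ?thesis using True by (auto intro: exI[of _ 1])
    next
      case (Suc m)
      obtain y where y: "f_elem r (Suc n) * f_elem r n = y * (1 - r n)"
        using f_elem_mult_f_elem[OF assms(1)] by blast
      have com: "r n * antisym_elem r m = antisym_elem r m * r n"
        by (rule antisym_commute, rule braidedD(2)[OF assms(1), symmetric]) (simp add: Suc)
      have "antisym_elem r (Suc n) = (f_elem r (Suc n) * f_elem r n) * antisym_elem r m"
        by (simp only: Suc antisym_elem.simps mult.assoc)
      also have "\<dots> = y * antisym_elem r m * (1 - r n)"
        unfolding y using com by (simp add: algebra_simps)
      finally show ?thesis using True by blast
    qed
  next
    case False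
    then obtain y where "antisym_elem r n = y * (1 - r k)" using Suc by auto
    then have "antisym_elem r (Suc n) = f_elem r (Suc n) * y * (1 - r k)"
      by (simp only: antisym_elem.simps mult.assoc)
    then show ?thesis by blast
  qed
qed simp

section \<open>The ring of graded matrices\<close>

text \<open>All three elements are built from 1, differences, products and the generators, so a
  relation compatible with these passes to them. A relation takes the place of a ring homomorphism
  because restricting indices is multiplicative only on suitable matrices; it serves both the shift
  of factors and the passage from R to \<sigma>.\<close>

lemma f_elem_g_elem_antisym_rel:
  fixes r :: "nat \<Rightarrow> 'r::ring_1" and s :: "nat \<Rightarrow> 's::ring_1"
  assumes one: "Q 1 1"
    and diff: "\<And>a b c d. Q a b \<Longrightarrow> Q c d \<Longrightarrow> Q (a - c) (b - d)"
    and mult: "\<And>a b c d. Q a b \<Longrightarrow> Q c d \<Longrightarrow> Q (a * c) (b * d)"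
    and gens: "\<And>k. Q (r k) (s k)"
  shows "Q (f_elem r n) (f_elem s n)" "Q (g_elem r n) (g_elem s n)" "Q (antisym_elem r n) (antisym_elem s n)"
proof -
  show f: "Q (f_elem r n) (f_elem s n)" for n
    by (induction n) (simp_all add: one diff mult gens)
  show "Q (g_elem r n) (g_elem s n)"
    using gens by (induction n arbitrary: r s) (simp_all add: one diff mult)
  show "Q (antisym_elem r n) (antisym_elem s n)"
    by (induction n) (simp_all del: f_elem.simps add: one mult f)
qed

lemma finite_lists_of_length: "finite {xs :: 'a::finite list. length xs = n}"
  using finite_lists_length_eq[of "UNIV :: 'a set" n] by simp

text \<open>The matrices on all numbers of tensor factors are collected into one ring, so that the identities
  above apply and shifts of the factors relate its elements to each other.\<close>

typedef (overloaded) ('a, 'k::zero) graded_matrix =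
  "{M :: 'a list \<Rightarrow> 'a list \<Rightarrow> 'k. \<forall>is ks. length is \<noteq> length ks \<longrightarrow> M is ks = 0}"
  morphisms entry Graded_matrix
  by (rule exI[of _ "\<lambda>_ _. 0"]) simp

setup_lifting type_definition_graded_matrix

instantiation graded_matrix :: (finite, field) ring_1
begin

lift_definition zero_graded_matrix :: "('a, 'b) graded_matrix" is "\<lambda>_ _. 0" by simp
lift_definition one_graded_matrix :: "('a, 'b) graded_matrix" is "\<lambda>is ks. if is = ks then 1 else 0"
  by auto
lift_definition plus_graded_matrix ::
  "('a, 'b) graded_matrix \<Rightarrow> ('a, 'b) graded_matrix \<Rightarrow> ('a, 'b) graded_matrix"
  is "\<lambda>M N is ks. M is ks + N is ks" by simp
lift_definition minus_graded_matrix ::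
  "('a, 'b) graded_matrix \<Rightarrow> ('a, 'b) graded_matrix \<Rightarrow> ('a, 'b) graded_matrix"
  is "\<lambda>M N is ks. M is ks - N is ks" by simp
lift_definition uminus_graded_matrix :: "('a, 'b) graded_matrix \<Rightarrow> ('a, 'b) graded_matrix"
  is "\<lambda>M is ks. - M is ks" by simp
lift_definition times_graded_matrix ::
  "('a, 'b) graded_matrix \<Rightarrow> ('a, 'b) graded_matrix \<Rightarrow> ('a, 'b) graded_matrix"
  is "\<lambda>M N is ls. \<Sum>ks | length ks = length is. M is ks * N ks ls"
  by (auto intro!: sum.neutral)

instance
proof
  fix a b c :: "('a, 'b) graded_matrix"
  show "a * b * c = a * (b * c)"
  proof transfer
    fix a b c :: "'a list \<Rightarrow> 'a list \<Rightarrow> 'b"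
    have "(\<Sum>ks | length ks = length is. (\<Sum>js | length js = length is. a is js * b js ks) * c ks ls) =
        (\<Sum>ks | length ks = length is. a is ks * (\<Sum>js | length js = length ks. b ks js * c js ls))"
      for "is" ls
    proof -
      have "(\<Sum>ks | length ks = length is. (\<Sum>js | length js = length is. a is js * b js ks) * c ks ls) =
          (\<Sum>ks | length ks = length is. \<Sum>js | length js = length is. a is js * (b js ks * c ks ls))"
        by (simp add: sum_distrib_right mult.assoc)
      also have "\<dots> = (\<Sum>js | length js = length is. \<Sum>ks | length ks = length is. a is js * (b js ks * c ks ls))"
        by (rule sum.swap)
      also have "\<dots> = (\<Sum>ks | length ks = length is. a is ks * (\<Sum>js | length js = length ks. b ks js * c js ls))"
        by (rule sum.cong) (simp_all add: sum_distrib_left)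
      finally show ?thesis .
    qed
    then show "(\<lambda>is ls. \<Sum>ks | length ks = length is. (\<Sum>js | length js = length is. a is js * b js ks) * c ks ls) =
        (\<lambda>is ls. \<Sum>ks | length ks = length is. a is ks * (\<Sum>js | length js = length ks. b ks js * c js ls))"
      by blast
  qed
  show "1 * a = a"
  proof (transfer, intro ext)
    fix a :: "'a list \<Rightarrow> 'a list \<Rightarrow> 'b" and "is" ls
    show "(\<Sum>ks | length ks = length is. (if is = ks then 1 else 0) * a ks ls) = a is ls"
      by (simp add: if_distrib[of "\<lambda>x. x * _"] sum.delta' finite_lists_of_length cong: if_cong)
  qed
  show "a * 1 = a"
  proof (transfer, intro ext)
    fix a :: "'a list \<Rightarrow> 'a list \<Rightarrow> 'b" and "is" ls
    assume "\<forall>is ks. length is \<noteq> length ks \<longrightarrow> a is ks = 0"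
    then show "(\<Sum>ks | length ks = length is. a is ks * (if ks = ls then 1 else 0)) = a is ls"
      by (auto simp: if_distrib[of "\<lambda>x. _ * x"] sum.delta finite_lists_of_length cong: if_cong)
  qed
  show "(0 :: ('a, 'b) graded_matrix) \<noteq> 1"
    by transfer (auto simp: fun_eq_iff)
qed (transfer; auto simp: fun_eq_iff algebra_simps sum.distrib)+

end

lemma entry_length: "length is \<noteq> length ks \<Longrightarrow> entry M is ks = 0"
  by transfer simp

lemma entry_zero [simp]: "entry 0 is ks = 0"
  by transfer simp

lemma entry_one: "entry 1 is ks = (if is = ks then 1 else 0)"
  by transfer simp

lemma entry_plus [simp]: "entry (M + N) is ks = entry M is ks + entry N is ks"
  by transfer simp

lemma entry_uminus [simp]: "entry (- M) is ks = - entry M is ks"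
  by transfer simp

lemma entry_minus [simp]: "entry (M - N) is ks = entry M is ks - entry N is ks"
  by transfer simp

lemma entry_times: "entry (M * N) is ls = (\<Sum>ks | length ks = length is. entry M is ks * entry N ks ls)"
  by transfer simp

lemma graded_matrix_eqI: "(\<And>is ks. entry M is ks = entry N is ks) \<Longrightarrow> M = N"
  by transfer (auto simp: fun_eq_iff)

text \<open>On lists that are too short the operator is \<open>0\<close>, so that the braid relations hold without
  restrictions.\<close>

lift_definition braid_op ::
    "'k::field^('a::finite \<times> 'a)^('a \<times> 'a) \<Rightarrow> nat \<Rightarrow> ('a, 'k) graded_matrix"
  is "\<lambda>R k is ks.
     if length is = length ks \<and> Suc k < length is \<and> take k is = take k ks \<and>
       drop (Suc (Suc k)) is = drop (Suc (Suc k)) ks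
     then R $ (is ! k, is ! Suc k) $ (ks ! k, ks ! Suc k) else 0"
  by simp

section \<open>Local action of a matrix on two neighbouring factors, and its braid relations\<close>

lemma list_split2:
  assumes "Suc k < length xs"
  shows "xs = take k xs @ xs ! k # xs ! Suc k # drop (Suc (Suc k)) xs"
  using assms by (metis Cons_nth_drop_Suc Suc_lessD id_take_nth_drop)

lemma entry_braid_op:
  "length us = k \<Longrightarrow> entry (braid_op R k) (us @ a # b # vs) (us @ c # d # vs) = R $ (a, b) $ (c, d)"
  by transfer (auto simp: nth_append)

lemma entry_braid_op_nonzeroD:
  assumes "entry (braid_op R k) is ks \<noteq> 0"
  obtains us a b c d vs where "length us = k" "is = us @ a # b # vs" "ks = us @ c # d # vs"
    "R $ (a, b) $ (c, d) \<noteq> 0"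
proof -
  from assms have "length is = length ks" "Suc k < length is" "take k is = take k ks"
      "drop (Suc (Suc k)) is = drop (Suc (Suc k)) ks" "R $ (is ! k, is ! Suc k) $ (ks ! k, ks ! Suc k) \<noteq> 0"
    by (transfer; auto split: if_splits)+
  then show ?thesis
    using that[of "take k is" "is ! k" "is ! Suc k" "drop (Suc (Suc k)) is" "ks ! k" "ks ! Suc k"]
      list_split2[of k "is"] list_split2[of k ks] by auto
qed

text \<open>Only the two upper indices in the window at \<open>k\<close> can vary, so the sum over
  lists collapses to a sum over pairs. \<open>s\<close> is left abstract to cover both products of
  entries and scalings of tensors.\<close>

lemma sum_braid_op:
  fixes g :: "'a::finite list \<Rightarrow> 'v::comm_monoid_add"
  assumes "length us = k" and zero: "\<And>x. s 0 x = 0"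
  shows "(\<Sum>ks | length ks = length (us @ a # b # vs). s (entry (braid_op R k) (us @ a # b # vs) ks) (g ks)) =
    (\<Sum>p\<in>UNIV. s (R $ (a, b) $ p) (g (us @ fst p # snd p # vs)))"
proof -
  let ?h = "\<lambda>p. us @ fst p # snd p # vs"
  let ?F = "\<lambda>ks. s (entry (braid_op R k) (us @ a # b # vs) ks) (g ks)"
  have "(\<Sum>ks | length ks = length (us @ a # b # vs). ?F ks) = sum ?F (range ?h)"
  proof (rule sum.mono_neutral_right)
    show "\<forall>ks\<in>{ks. length ks = length (us @ a # b # vs)} - range ?h. ?F ks = 0"
    proof
      fix ks assume ks: "ks \<in> {ks. length ks = length (us @ a # b # vs)} - range ?h"
      have "entry (braid_op R k) (us @ a # b # vs) ks = 0"
      proof (rule ccontr)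
        assume "entry (braid_op R k) (us @ a # b # vs) ks \<noteq> 0"
        then obtain us' a' b' c' d' vs' where *: "length us' = k"
          "us @ a # b # vs = us' @ a' # b' # vs'" "ks = us' @ c' # d' # vs'"
          by (rule entry_braid_op_nonzeroD)
        then have "ks = ?h (c', d')" using assms by simp
        then show False using ks by blast
      qed
      then show "?F ks = 0" by (simp add: zero)
    qed
  qed (auto simp: finite_lists_of_length)
  also have "\<dots> = (\<Sum>p\<in>UNIV. ?F (?h p))"
    by (subst sum.reindex) (auto simp: inj_on_def prod_eq_iff)
  also have "\<dots> = (\<Sum>p\<in>UNIV. s (R $ (a, b) $ p) (g (?h p)))"
    using assms by (simp add: entry_braid_op)
  finally show ?thesis .
qed

lemma entry_braid_op_mult:
  assumes "length us = k"
  shows "entry (braid_op R k * M) (us @ a # b # vs) ls =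
    (\<Sum>p\<in>UNIV. R $ (a, b) $ p * entry M (us @ fst p # snd p # vs) ls)"
  unfolding entry_times using assms by (rule sum_braid_op) simp

lemma entry_braid_op_short: "length is \<le> Suc k \<Longrightarrow> entry (braid_op R k) is ks = 0"
  by transfer auto

lemma entry_braid_op_mult_short: "length is \<le> Suc k \<Longrightarrow> entry (braid_op R k * M) is ls = 0"
  by (simp add: entry_times entry_braid_op_short)

lemma braid_op_far_commute:
  assumes "Suc i < j"
  shows "braid_op R i * braid_op R j = braid_op R j * braid_op R i"
proof -
  \<comment> \<open>The trailing 1 lets \<open>entry_braid_op_mult\<close> expand the second
    operator too. The windows are disjoint, so the two expansions are one double sum in either
    order.\<close>
  have "entry (braid_op R i * (braid_op R j * 1)) is ls = entry (braid_op R j * (braid_op R i * 1)) is ls" for "is" ls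
  proof (cases "Suc j < length is")
    case True
    define us a b where "us = take i is" "a = is ! i" "b = is ! Suc i"
    define xs where "xs = drop (Suc (Suc i)) is"
    define vs c d ws where "vs = take (j - Suc (Suc i)) xs" "c = xs ! (j - Suc (Suc i))"
      "d = xs ! Suc (j - Suc (Suc i))" "ws = drop (Suc (Suc (j - Suc (Suc i)))) xs"
    have eq: "is = us @ a # b # vs @ c # d # ws"
      using list_split2[of i "is"] list_split2[of "j - Suc (Suc i)" xs] True assms
      unfolding us_a_b_def vs_c_d_ws_def xs_def by simp
    have len: "length us = i" "length (us @ x # y # vs) = j" for x y
      using True assms unfolding us_a_b_def vs_c_d_ws_def xs_def by auto
    have j: "entry (braid_op R j * M) (us @ x # y # vs @ c # d # ws) ls =
      (\<Sum>p\<in>UNIV. R $ (c, d) $ p * entry M (us @ x # y # vs @ fst p # snd p # ws) ls)" for x y M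
      using entry_braid_op_mult[OF len(2), of R M x y c d ws ls] by simp
    show ?thesis
      unfolding eq entry_braid_op_mult[OF len(1)] j sum_distrib_left
      by (subst sum.swap) (simp add: mult.left_commute)
  next
    case False
    show ?thesis
    proof (cases "Suc i < length is")
      case True
      show ?thesis
        by (subst list_split2[OF True], subst entry_braid_op_mult)
          (use False True in \<open>auto simp: entry_braid_op_mult_short entry_braid_op_short\<close>)
    next
      case False
      then show ?thesis using assms by (simp add: entry_braid_op_mult_short)
    qed
  qed
  then show ?thesis by (intro graded_matrix_eqI) simp
qed

text \<open>The component on \<open>n\<close> tensor factors. Testing the lower list suffices, since
  entries with lists of different lengths vanish.\<close>

definition block :: "nat \<Rightarrow> ('a::finite, 'k::field) graded_matrix \<Rightarrow> ('a, 'k) multimatrix" where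
  "block n M is ks = (if length is = n then entry M is ks else 0)"

lemma block_one: "block n 1 = multi_id n"
  by (auto simp: fun_eq_iff block_def multi_id_def entry_one)

lemma block_mult: "block n (M * N) = multi_mult n (block n M) (block n N)"
  by (auto simp: fun_eq_iff block_def multi_mult_def entry_times intro!: sum.cong)

lemma block_braid_op:
  assumes "Suc k < n"
  shows "block n (braid_op R k) = in_factors n R (Suc k)"
proof (intro ext)
  fix "is" ks :: "'a list"
  have "take k is = take k ks \<and> drop (Suc (Suc k)) is = drop (Suc (Suc k)) ks \<longleftrightarrow>
      (\<forall>p<n. p \<noteq> k \<and> p \<noteq> Suc k \<longrightarrow> is ! p = ks ! p)" if len: "length is = n" "length ks = n"
  proof
    assume *: "take k is = take k ks \<and> drop (Suc (Suc k)) is = drop (Suc (Suc k)) ks"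
    show "\<forall>p<n. p \<noteq> k \<and> p \<noteq> Suc k \<longrightarrow> is ! p = ks ! p"
    proof (intro allI impI)
      fix p assume p: "p < n" "p \<noteq> k \<and> p \<noteq> Suc k"
      then consider "p < k" | "p = Suc (Suc k) + (p - Suc (Suc k))" by linarith
      then show "is ! p = ks ! p"
      proof cases
        case 1
        then show ?thesis using * by (metis nth_take)
      next
        case 2
        then show ?thesis using * len p assms by (metis nth_drop Suc_leI)
      qed
    qed
  next
    assume "\<forall>p<n. p \<noteq> k \<and> p \<noteq> Suc k \<longrightarrow> is ! p = ks ! p"
    then show "take k is = take k ks \<and> drop (Suc (Suc k)) is = drop (Suc (Suc k)) ks"
      using len assms by (auto intro!: nth_equalityI)
  qed
  moreover have "entry (braid_op R k) is ks = (if length is = length ks \<and> Suc k < length is \<and> take k is = take k ks \<and>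
       drop (Suc (Suc k)) is = drop (Suc (Suc k)) ks
     then R $ (is ! k, is ! Suc k) $ (ks ! k, ks ! Suc k) else 0)"
    by transfer simp
  ultimately show "block n (braid_op R k) is ks = in_factors n R (Suc k) is ks"
    using assms unfolding block_def in_factors_def by auto
qed

text \<open>The hypothesis speaks of exactly three factors. Both sides act only on a window of three
  places and carry the surrounding lists along, so the identity moves to every place of every longer
  list.\<close>

lemma braided_braid_op:
  fixes R :: "'k::field^('a::finite \<times> 'a)^('a \<times> 'a)"
  assumes "yang_baxter R"
  shows "braided (braid_op R)"
proof -
  let ?r = "braid_op R"
  have expand: "entry (?r k * (?r (Suc k) * (?r k * 1))) (us @ a # b # c # vs) ls =
      (\<Sum>p\<in>UNIV. R $ (a, b) $ p * (\<Sum>q\<in>UNIV. R $ (snd p, c) $ q * (\<Sum>s\<in>UNIV. R $ (fst p, fst q) $ s *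
        entry 1 (us @ fst s # snd s # snd q # vs) ls)))"
    "entry (?r (Suc k) * (?r k * (?r (Suc k) * 1))) (us @ a # b # c # vs) ls =
      (\<Sum>p\<in>UNIV. R $ (b, c) $ p * (\<Sum>q\<in>UNIV. R $ (a, fst p) $ q * (\<Sum>s\<in>UNIV. R $ (snd q, snd p) $ s *
        entry 1 (us @ fst q # fst s # snd s # vs) ls)))"
    if us: "length us = k" for us vs ls a b c k
  proof -
    have k: "entry (?r k * M) (us @ x # y # z # vs) ls =
      (\<Sum>p\<in>UNIV. R $ (x, y) $ p * entry M (us @ fst p # snd p # z # vs) ls)" for M x y z
      using us by (rule entry_braid_op_mult)
    have Suc_k: "entry (?r (Suc k) * M) (us @ x # y # z # vs) ls =
      (\<Sum>p\<in>UNIV. R $ (y, z) $ p * entry M (us @ x # fst p # snd p # vs) ls)" for M x y z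
      using us entry_braid_op_mult[of "us @ [x]" "Suc k" R M y z vs ls] by simp
    show "entry (?r k * (?r (Suc k) * (?r k * 1))) (us @ a # b # c # vs) ls =
      (\<Sum>p\<in>UNIV. R $ (a, b) $ p * (\<Sum>q\<in>UNIV. R $ (snd p, c) $ q * (\<Sum>s\<in>UNIV. R $ (fst p, fst q) $ s *
        entry 1 (us @ fst s # snd s # snd q # vs) ls)))"
      unfolding k Suc_k ..
    show "entry (?r (Suc k) * (?r k * (?r (Suc k) * 1))) (us @ a # b # c # vs) ls =
      (\<Sum>p\<in>UNIV. R $ (b, c) $ p * (\<Sum>q\<in>UNIV. R $ (a, fst p) $ q * (\<Sum>s\<in>UNIV. R $ (snd q, snd p) $ s *
        entry 1 (us @ fst q # fst s # snd s # vs) ls)))"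
      unfolding k Suc_k ..
  qed
  have blocks: "block 3 (?r 0) = in_factors 3 R 1" "block 3 (?r (Suc 0)) = in_factors 3 R 2"
    using block_braid_op[of 0 3 R] block_braid_op[of 1 3 R] by (simp_all add: numeral_2_eq_2)
  have "block 3 (?r 0 * ?r (Suc 0) * ?r 0) is ls = block 3 (?r (Suc 0) * ?r 0 * ?r (Suc 0)) is ls"
    for "is" ls
    using assms unfolding block_mult blocks yang_baxter_def by simp
  from this[of "[a, b, c]" "[x, y, z]" for a b c x y z]
  have three: "entry (?r 0 * (?r (Suc 0) * (?r 0 * 1))) [a, b, c] [x, y, z] =
      entry (?r (Suc 0) * (?r 0 * (?r (Suc 0) * 1))) [a, b, c] [x, y, z]" for a b c x y z
    by (simp add: block_def mult.assoc)
  have "entry (?r k * (?r (Suc k) * (?r k * 1))) is ls = entry (?r (Suc k) * (?r k * (?r (Suc k) * 1))) is ls" for k "is" ls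
  proof (cases "Suc (Suc k) < length is")
    case True
    define us a b c vs where "us = take k is" "a = is ! k" "b = is ! Suc k" "c = is ! Suc (Suc k)"
      "vs = drop (Suc (Suc (Suc k))) is"
    have eq: "is = us @ a # b # c # vs"
      using list_split2[of k "is"] True Cons_nth_drop_Suc[OF True] unfolding us_a_b_c_vs_def by simp
    have us: "length us = k" using True unfolding us_a_b_c_vs_def by simp
    show ?thesis
    proof (cases "\<exists>x y z. ls = us @ x # y # z # vs")
      case True
      then obtain x y z where ls: "ls = us @ x # y # z # vs" by blast
      \<comment> \<open>With the same surroundings in \<open>ls\<close>, the innermost unit entry
        sees only the three window indices, and both sides become sums for the three-factor
        identity.\<close>
      have one: "entry (1 :: ('a, 'k) graded_matrix) (us @ x' # y' # z' # vs) ls = entry 1 ([] @ x' # y' # z' # []) [x, y, z]" for x' y' z'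
        by (simp add: entry_one ls)
      show ?thesis
        unfolding eq expand[OF us] one
        using three[of a b c x y z] expand[of "[]" 0 a b c "[]" "[x, y, z]"] by simp
    next
      case False
      then have "entry (1 :: ('a, 'k) graded_matrix) (us @ x' # y' # z' # vs) ls = 0" for x' y' z'
        by (auto simp: entry_one)
      then show ?thesis unfolding eq expand[OF us] by simp
    qed
  next
    \<comment> \<open>The window does not fit, so \<open>braid_op R (Suc k)\<close>, a factor of
      both sides, vanishes on lists of this length.\<close>
    case False
    show ?thesis
    proof (cases "Suc k < length is")
      case True
      show ?thesis
        by (subst list_split2[OF True], subst entry_braid_op_mult)
          (use False True in \<open>auto simp: entry_braid_op_mult_short entry_braid_op_short\<close>)
    next
      case False
      then show ?thesis by (simp add: entry_braid_op_mult_short)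
    qed
  qed
  then have "?r k * ?r (Suc k) * ?r k = ?r (Suc k) * ?r k * ?r (Suc k)" for k
    by (intro graded_matrix_eqI) (simp add: mult.assoc)
  then show ?thesis
    unfolding braided_def using braid_op_far_commute by blast
qed

section \<open>Agreement with the antisymmetrizers on a fixed number of factors\<close>

lemma f_elem_conv_sum:
  "f_elem r n = (\<Sum>j\<le>n. (-1) ^ j * foldr (*) (map r [n - j..<n]) 1)"
proof (induction n)
  case (Suc n)
  have fold: "foldr (*) xs y = foldr (*) xs 1 * y" for xs and y :: 'a
    by (induction xs) (simp_all add: mult.assoc)
  have "f_elem r (Suc n) = 1 - (\<Sum>j\<le>n. (-1) ^ j * foldr (*) (map r [n - j..<n]) 1) * r n"
    by (simp add: Suc)
  also have "\<dots> = 1 + (\<Sum>j\<le>n. (-1) ^ Suc j * (foldr (*) (map r [n - j..<n]) 1 * r n))"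
    by (simp add: sum_distrib_right sum_negf mult.assoc)
  also have "\<dots> = 1 + (\<Sum>j\<le>n. (-1) ^ Suc j * foldr (*) (map r [Suc n - Suc j..<Suc n]) 1)"
    by (simp add: fold[of _ "r n"])
  also have "\<dots> = (\<Sum>j\<le>Suc n. (-1) ^ j * foldr (*) (map r [Suc n - j..<Suc n]) 1)"
    by (subst sum.atMost_Suc_shift) simp
  finally show ?case .
qed simp

lemma entry_sum: "entry (\<Sum>x\<in>A. M x) is ks = (\<Sum>x\<in>A. entry (M x) is ks)"
  by (induction A rule: infinite_finite_induct) auto

lemma entry_sign_mult: "entry ((-1) ^ j * M) is ks = (-1) ^ j * entry M is ks"
  by (cases "even j") auto

lemma f_op_eq_block:
  assumes "m < n"
  shows "f_op n R (Suc m) = block n (f_elem (braid_op R) m)"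
proof (intro ext)
  fix "is" ks :: "'a list"
  have fold: "foldr (multi_mult n) (map (in_factors n R) [Suc m - j..<Suc m]) (multi_id n) =
      block n (foldr (*) (map (braid_op R) [m - j..<m]) 1)" if "j \<le> m" for j
  proof -
    have "foldr (multi_mult n) (map (\<lambda>k. in_factors n R (Suc k)) xs) (multi_id n) =
        block n (foldr (*) (map (braid_op R) xs) 1)" if "\<forall>k\<in>set xs. k < m" for xs
      using that assms by (induction xs) (auto simp: block_one block_mult block_braid_op)
    moreover have "map (in_factors n R) [Suc m - j..<Suc m] = map (\<lambda>k. in_factors n R (Suc k)) [m - j..<m]"
      using that by (simp add: map_Suc_upt[symmetric] Suc_diff_le del: upt_Suc)
    ultimately show ?thesis by simp
  qed
  have "f_op n R (Suc m) is ks =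
      (\<Sum>j\<le>m. (-1) ^ j * block n (foldr (*) (map (braid_op R) [m - j..<m]) 1) is ks)"
    unfolding f_op_def lessThan_Suc_atMost by (intro sum.cong refl) (simp add: fold del: upt_Suc)
  also have "\<dots> = block n (f_elem (braid_op R) m) is ks"
    by (simp add: block_def f_elem_conv_sum entry_sum entry_sign_mult)
  finally show "f_op n R (Suc m) is ks = block n (f_elem (braid_op R) m) is ks" .
qed

lemma antisymmetrizer_eq_block:
  "m < n \<Longrightarrow> antisymmetrizer n R (Suc m) = block n (antisym_elem (braid_op R) m)"
proof (induction m)
  case (Suc m)
  then show ?case by (simp only: antisymmetrizer.simps antisym_elem.simps f_op_eq_block block_mult Suc_lessD)
qed (simp add: block_one)

lemma antisymmetrizer_eq_entry:
  assumes "length is = n"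
  shows "antisymmetrizer n R n is ks = entry (antisym_elem (braid_op R) (n - 1)) is ks"
proof (cases n)
  case 0
  then show ?thesis using assms by (simp add: multi_id_def entry_one)
next
  case (Suc m)
  then show ?thesis using assms antisymmetrizer_eq_block[of m n R] by (simp add: block_def)
qed

lemma entry_antisym_shift:
  fixes R :: "'k::field^('a::finite \<times> 'a)^('a \<times> 'a)"
  shows "entry (antisym_elem (\<lambda>k. braid_op R (Suc k)) n) (x # is) (y # ks) =
    (if x = y then entry (antisym_elem (braid_op R) n) is ks else 0)"
proof -
  \<comment> \<open>\<open>Q M M'\<close> expresses that \<open>M'\<close> is the identity on the
    first factor tensored with \<open>M\<close>. It leaves entries at empty lists open, which never
    enter products on nonempty lists.\<close>
  define Q where "Q M M' \<longleftrightarrow> (\<forall>x y is ks. entry M' (x # is) (y # ks) = (if x = y then entry M is ks else 0))"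
    for M M' :: "('a, 'k) graded_matrix"
  have "Q (antisym_elem (braid_op R) n) (antisym_elem (\<lambda>k. braid_op R (Suc k)) n)"
  proof (rule f_elem_g_elem_antisym_rel(3))
    fix a b c d assume Q: "Q a b" "Q c d"
    show "Q (a - c) (b - d)" using Q unfolding Q_def by simp
    have "entry (b * d) (x # is) (y # ls) = (if x = y then entry (a * c) is ls else 0)" for x y "is" ls
    proof -
      have "entry (b * d) (x # is) (y # ls) =
          (\<Sum>ks\<in>(#) x ` {ks. length ks = length is}. entry b (x # is) ks * entry d ks (y # ls))"
        unfolding entry_times
      proof (rule sum.mono_neutral_right)
        show "\<forall>ks\<in>{ks. length ks = length (x # is)} - (#) x ` {ks. length ks = length is}.
            entry b (x # is) ks * entry d ks (y # ls) = 0"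
        proof
          fix ks assume ks: "ks \<in> {ks. length ks = length (x # is)} - (#) x ` {ks. length ks = length is}"
          then obtain z zs where "ks = z # zs" by (cases ks) auto
          then show "entry b (x # is) ks * entry d ks (y # ls) = 0"
            using ks Q unfolding Q_def by auto
        qed
      qed (auto simp: finite_lists_of_length)
      also have "\<dots> = (if x = y then entry (a * c) is ls else 0)"
        using Q by (subst sum.reindex) (auto simp: entry_times Q_def)
      finally show ?thesis .
    qed
    then show "Q (a * c) (b * d)" unfolding Q_def by blast
  next
    show "Q 1 1" unfolding Q_def by (simp add: entry_one)
    show "Q (braid_op R k) (braid_op R (Suc k))" for k
      unfolding Q_def by transfer auto
  qed
  then show ?thesis unfolding Q_def by blast
qed

section \<open>The extended Yang--Baxter matrix\<close>

lemma sum_UNIV_option: "(\<Sum>A\<in>UNIV. f A) = f None + (\<Sum>i\<in>UNIV. f (Some (i :: 'i::finite)))"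
  by (simp add: UNIV_option_conv sum.reindex)

lemma qla_R_nth: "qla_R \<sigma> C $ p $ q = qla_R_entry \<sigma> C p q"
  by (simp add: qla_R_def)

lemma qla_R_no_None:
  assumes "qla_R \<sigma> C $ (A, B) $ (Some k, Some l) \<noteq> 0"
  shows "A \<noteq> None" "B \<noteq> None"
  using assms by (auto simp: qla_R_nth qla_R_entry_def split: option.splits if_splits)

lemma qla_R_None_right:
  assumes "qla_R \<sigma> C $ (A, B) $ (D, None) \<noteq> 0"
  shows "A = None"
  using assms by (auto simp: qla_R_nth qla_R_entry_def split: option.splits if_splits)

lemma list_without_None:
  assumes "None \<notin> set Ks"
  obtains ks where "Ks = map Some ks"
proof -
  have "map (Some \<circ> the) Ks = Ks" 
  proof (rule map_idI)
    show "(Some \<circ> the) x = x" if "x \<in> set Ks" for x by (cases x) (use that assms in auto)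
  qed
  then show ?thesis using that[of "map the Ks"] by simp
qed

lemma map_Some_lists: "{Ks. length Ks = n \<and> None \<notin> set Ks} = map Some ` {ks. length ks = n}"
  by (auto elim: list_without_None)

lemma inj_map_Some: "inj_on (map Some) S"
  by (simp add: inj_on_def)

text \<open>An index \<open>None\<close> never disappears from the lower to the upper multi-index. This makes
  the restriction to the other indices multiplicative.\<close>

lemma antisym_qla_R:
  fixes \<sigma> :: "'k::field^('i::finite \<times> 'i)^('i \<times> 'i)"
  shows "None \<notin> set Ks \<Longrightarrow> entry (antisym_elem (braid_op (qla_R \<sigma> C)) n) Is Ks \<noteq> 0 \<Longrightarrow> None \<notin> set Is"
    and "entry (antisym_elem (braid_op (qla_R \<sigma> C)) n) (map Some is) (map Some ks) =
      entry (antisym_elem (braid_op \<sigma>) n) is ks"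
proof -
  define Q where "Q M N \<longleftrightarrow>
      (\<forall>Is Ks. None \<notin> set Ks \<longrightarrow> entry M Is Ks \<noteq> 0 \<longrightarrow> None \<notin> set Is) \<and>
      (\<forall>is ks. entry M (map Some is) (map Some ks) = entry N is ks)"
    for M :: "('i option, 'k) graded_matrix" and N :: "('i, 'k) graded_matrix"
  have "Q (antisym_elem (braid_op (qla_R \<sigma> C)) n) (antisym_elem (braid_op \<sigma>) n)"
  proof (rule f_elem_g_elem_antisym_rel(3))
    show "Q 1 1" unfolding Q_def by (auto simp: entry_one)
  next
    fix a b c d assume Q: "Q a b" "Q c d"
    show "Q (a - c) (b - d)"
    proof -
      have "None \<notin> set Is" if "None \<notin> set Ks" "entry (a - c) Is Ks \<noteq> 0" for Is Ks
      proof -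
        from that(2) have "entry a Is Ks \<noteq> 0 \<or> entry c Is Ks \<noteq> 0" by auto
        then show ?thesis using Q that(1) unfolding Q_def by blast
      qed
      moreover have "entry (a - c) (map Some is) (map Some ks) = entry (b - d) is ks" for "is" ks
      proof -
        have "entry a (map Some is) (map Some ks) = entry b is ks"
          "entry c (map Some is) (map Some ks) = entry d is ks"
          using Q unfolding Q_def by blast+
        then show ?thesis by simp
      qed
      ultimately show ?thesis unfolding Q_def by blast
    qed
    have "None \<notin> set Is" if "None \<notin> set Ks" "entry (a * c) Is Ks \<noteq> 0" for Is Ks
    proof -
      from that(2) obtain Js where "entry a Is Js * entry c Js Ks \<noteq> 0"
        unfolding entry_times by (meson sum.not_neutral_contains_not_neutral)
      then have "entry a Is Js \<noteq> 0" "entry c Js Ks \<noteq> 0" by auto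
      then show ?thesis using Q that(1) unfolding Q_def by blast
    qed
    moreover have "entry (a * c) (map Some is) (map Some ls) = entry (b * d) is ls" for "is" ls
    proof -
      \<comment> \<open>Intermediate lists containing \<open>None\<close> contribute nothing, by the
        first half of \<open>Q\<close> for \<open>c\<close>.\<close>
      have "entry (a * c) (map Some is) (map Some ls) =
          (\<Sum>Ks\<in>map Some ` {ks. length ks = length is}. entry a (map Some is) Ks * entry c Ks (map Some ls))"
        unfolding entry_times
      proof (rule sum.mono_neutral_right)
        show "\<forall>Ks\<in>{Ks. length Ks = length (map Some is)} - map Some ` {ks. length ks = length is}.
            entry a (map Some is) Ks * entry c Ks (map Some ls) = 0"
        proof
          fix Ks :: "'i option list"
          assume "Ks \<in> {Ks. length Ks = length (map Some is)} - map Some ` {ks. length ks = length is}"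
          then have "None \<in> set Ks" unfolding map_Some_lists[symmetric] by simp
          moreover have "None \<notin> set (map Some ls)" by auto
          ultimately have "entry c Ks (map Some ls) = 0" using Q(2) unfolding Q_def by blast
          then show "entry a (map Some is) Ks * entry c Ks (map Some ls) = 0" by simp
        qed
      qed (auto simp: finite_lists_of_length)
      also have "\<dots> = entry (b * d) is ls"
      proof -
        have "entry a (map Some is) (map Some ks) = entry b is ks"
          "entry c (map Some ks) (map Some ls) = entry d ks ls" for ks
          using Q unfolding Q_def by blast+
        then show ?thesis by (simp add: sum.reindex inj_map_Some entry_times)
      qed
      finally show ?thesis .
    qed
    ultimately show "Q (a * c) (b * d)" unfolding Q_def by blast
  next
    fix k
    have "None \<notin> set Is" if Ks: "None \<notin> set Ks" and nz: "entry (braid_op (qla_R \<sigma> C) k) Is Ks \<noteq> 0" for Is Ks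
    proof -
      from nz obtain us A B D E vs where *: "Is = us @ A # B # vs" "Ks = us @ D # E # vs"
        "qla_R \<sigma> C $ (A, B) $ (D, E) \<noteq> 0"
        by (rule entry_braid_op_nonzeroD)
      with Ks obtain d e where "D = Some d" "E = Some e" by (cases D; cases E) auto
      then show ?thesis using * Ks qla_R_no_None by fastforce
    qed
    moreover have "entry (braid_op (qla_R \<sigma> C) k) (map Some is) (map Some ks) = entry (braid_op \<sigma> k) is ks" for "is" ks
      by transfer
        (auto simp: take_map drop_map qla_R_nth qla_R_entry_def inj_map_eq_map nth_map)
    ultimately show "Q (braid_op (qla_R \<sigma> C) k) (braid_op \<sigma> k)" unfolding Q_def by blast
  qed
  then show "None \<notin> set Ks \<Longrightarrow> entry (antisym_elem (braid_op (qla_R \<sigma> C)) n) Is Ks \<noteq> 0 \<Longrightarrow> None \<notin> set Is"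
    and "entry (antisym_elem (braid_op (qla_R \<sigma> C)) n) (map Some is) (map Some ks) =
      entry (antisym_elem (braid_op \<sigma>) n) is ks"
    unfolding Q_def by blast+
qed

text \<open>An upper 0 on the right place of R forces a lower 0 on the left one. So the last
  operator in each word moves the \<open>None\<close> from place m + 1 to place m, until it would
  have to be a lower index of the whole product.\<close>

lemma f_elem_qla_R_None:
  assumes "m < length is" "Ks ! m = None"
  shows "entry (f_elem (braid_op (qla_R \<sigma> C)) m) (map Some is) Ks = 0"
  using assms
proof (induction m arbitrary: Ks)
  case 0
  then show ?case by (auto simp: entry_one)
next
  case (Suc m)
  let ?r = "braid_op (qla_R \<sigma> C)"
  have "entry (f_elem ?r m) (map Some is) Js * entry (?r m) Js Ks = 0" for Js
  proof (cases "entry (?r m) Js Ks = 0")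
    case False
    then obtain us A B D E vs where *: "length us = m" "Js = us @ A # B # vs" "Ks = us @ D # E # vs"
        "qla_R \<sigma> C $ (A, B) $ (D, E) \<noteq> 0"
      by (rule entry_braid_op_nonzeroD)
    then have "E = None" using Suc.prems(2) by (simp add: nth_append)
    then have "A = None" using * qla_R_None_right by blast
    then have "Js ! m = None" using * by (simp add: nth_append)
    then show ?thesis using Suc by simp
  qed simp
  moreover have "map Some is \<noteq> Ks" using Suc.prems by auto
  ultimately show ?case by (auto simp: entry_times entry_one intro!: sum.neutral)
qed

lemma entry_f_elem_nth:
  assumes "entry (f_elem (braid_op R) m) is ks \<noteq> 0" "m < p" "p < length is"
  shows "is ! p = ks ! p"
  using assms
proof (induction m arbitrary: ks)
  case 0
  then show ?case by (auto simp: entry_one split: if_splits)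
next
  case (Suc m)
  show ?case
  proof (cases "is = ks")
    case False
    then have "(\<Sum>js | length js = length is. entry (f_elem (braid_op R) m) is js * entry (braid_op R m) js ks) \<noteq> 0"
      using Suc.prems(1) by (simp add: entry_times entry_one)
    then obtain js where "entry (f_elem (braid_op R) m) is js * entry (braid_op R m) js ks \<noteq> 0"
      by (meson sum.not_neutral_contains_not_neutral)
    then have js: "entry (f_elem (braid_op R) m) is js \<noteq> 0" "entry (braid_op R m) js ks \<noteq> 0" by auto
    from js(2) obtain us a b c d vs where "length us = m" "js = us @ a # b # vs" "ks = us @ c # d # vs"
      by (rule entry_braid_op_nonzeroD)
    then have "js ! p = ks ! p" using Suc.prems by (simp add: nth_append nth_Cons')
    then show ?thesis using Suc.IH[OF js(1)] Suc.prems by simp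
  qed simp
qed

lemma entry_antisym_nth:
  assumes "entry (antisym_elem (braid_op R) m) is ks \<noteq> 0" "m < p" "p < length is"
  shows "is ! p = ks ! p"
  using assms
proof (induction m arbitrary: "is")
  case 0
  then show ?case by (auto simp: entry_one split: if_splits)
next
  case (Suc m)
  let ?F = "\<lambda>js. entry (f_elem (braid_op R) (Suc m)) is js * entry (antisym_elem (braid_op R) m) js ks"
  have "sum ?F {js. length js = length is} \<noteq> 0"
    using Suc.prems(1) unfolding antisym_elem.simps entry_times .
  then obtain js where j: "js \<in> {js. length js = length is}" "?F js \<noteq> 0"
    by (rule sum.not_neutral_contains_not_neutral)
  then have "entry (f_elem (braid_op R) (Suc m)) is js \<noteq> 0" "entry (antisym_elem (braid_op R) m) js ks \<noteq> 0"
    by auto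
  then have "is ! p = js ! p" "js ! p = ks ! p"
    using entry_f_elem_nth[of R "Suc m" "is" js p] Suc.IH[of js] Suc.prems j(1) by auto
  then show ?case by simp
qed

text \<open>The vanishing of D_n: behind the leading \<open>f_elem\<close> stands an antisymmetrizer
  that does not touch place \<open>m\<close>, so a \<open>None\<close> there is already an upper
  index of that \<open>f_elem\<close>.\<close>

lemma antisym_qla_R_None:
  assumes "m < length is" "Ks ! m = None"
  shows "entry (antisym_elem (braid_op (qla_R \<sigma> C)) m) (map Some is) Ks = 0"
proof (cases m)
  case 0
  then show ?thesis using assms by (auto simp: entry_one)
next
  case (Suc l)
  let ?r = "braid_op (qla_R \<sigma> C)"
  have "entry (f_elem ?r m) (map Some is) Js * entry (antisym_elem ?r l) Js Ks = 0" if "length Js = length is" for Js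
  proof (cases "entry (antisym_elem ?r l) Js Ks = 0")
    case False
    then have "Js ! m = Ks ! m" by (rule entry_antisym_nth) (use assms Suc that in auto)
    then show ?thesis using f_elem_qla_R_None[OF assms(1), of Js \<sigma> C] assms(2) by simp
  qed simp
  then show ?thesis by (auto simp: Suc entry_times simp del: f_elem.simps intro!: sum.neutral)
qed

text \<open>Reads the left factorization in components. The right factor fixes the first index
  \<open>J\<close>, and as no other upper index is \<open>None\<close>, the intermediate ones are
  not either; there it is the antisymmetrizer of \<sigma>. The multi-index \<open>js\<close> becomes
  the lower one of a wedge product.\<close>

lemma antisym_qla_R_factor:
  assumes "yang_baxter (qla_R \<sigma> C)"
  shows "\<exists>G. \<forall>J ks. length ks = m \<longrightarrow>
    entry (antisym_elem (braid_op (qla_R \<sigma> C)) m) Is (J # map Some ks) =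
      (\<Sum>js | length js = m. G J js * antisymmetrizer m \<sigma> m js ks)"
proof (cases m)
  case 0
  then show ?thesis
    by (auto simp: multi_id_def intro!: exI[of _ "\<lambda>J js. entry 1 Is (J # map Some js)"])
next
  case (Suc l)
  let ?r = "braid_op (qla_R \<sigma> C)"
  have "entry (antisym_elem ?r m) Is (J # map Some ks) =
      (\<Sum>js | length js = m. entry (g_elem ?r m) Is (J # map Some js) * antisymmetrizer m \<sigma> m js ks)"
    if ks: "length ks = m" for J ks
  proof (cases "length Is = Suc m")
    case False
    then show ?thesis using ks by (simp add: entry_length)
  next
    case True
    let ?F = "\<lambda>Js. entry (g_elem ?r m) Is Js * entry (antisym_elem (\<lambda>k. ?r (Suc k)) l) Js (J # map Some ks)"
    let ?h = "\<lambda>js. J # map Some js"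
    have "entry (antisym_elem ?r m) Is (J # map Some ks) = (\<Sum>Js | length Js = Suc m. ?F Js)"
      unfolding Suc antisym_left_factor[OF braided_braid_op[OF assms]] entry_times True[unfolded Suc] ..
    also have "\<dots> = sum ?F (?h ` {js. length js = m})"
    proof (rule sum.mono_neutral_right)
      show "\<forall>Js\<in>{Js. length Js = Suc m} - ?h ` {js. length js = m}. ?F Js = 0"
      proof
        fix Js assume Js: "Js \<in> {Js. length Js = Suc m} - ?h ` {js. length js = m}"
        then obtain J' Js' where J: "Js = J' # Js'" by (cases Js) auto
        have "entry (antisym_elem (\<lambda>k. ?r (Suc k)) l) (J' # Js') (J # map Some ks) = 0"
        proof (rule ccontr)
          assume "entry (antisym_elem (\<lambda>k. ?r (Suc k)) l) (J' # Js') (J # map Some ks) \<noteq> 0"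
          then have *: "J' = J" "entry (antisym_elem ?r l) Js' (map Some ks) \<noteq> 0"
            unfolding entry_antisym_shift by (auto split: if_splits)
          have "None \<notin> set Js'" by (rule antisym_qla_R(1)[OF _ *(2)]) auto
          then obtain js where "Js' = map Some js" by (rule list_without_None)
          then show False using Js J * by auto
        qed
        then show "?F Js = 0" unfolding J by simp
      qed
    qed (auto simp: finite_lists_of_length)
    also have "\<dots> = (\<Sum>js | length js = m. ?F (?h js))"
      by (subst sum.reindex) (auto simp: inj_on_def)
    also have "\<dots> = (\<Sum>js | length js = m. entry (g_elem ?r m) Is (?h js) * antisymmetrizer m \<sigma> m js ks)"
      by (rule sum.cong) (auto simp: entry_antisym_shift antisym_qla_R(2) antisymmetrizer_eq_entry Suc)
    finally show ?thesis .
  qed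
  then show ?thesis by (intro exI[of _ "\<lambda>J js. entry (g_elem ?r m) Is (J # map Some js)"]) blast
qed

section \<open>Chains and the relations of the algebra\<close>

context vector_space
begin

lemma linear_extension_on_superset:
  assumes "finite A" "Poly_Mapping.keys p \<subseteq> A"
  shows "linear_extension scale f p = (\<Sum>x\<in>A. scale (Poly_Mapping.lookup p x) (f x))"
  unfolding linear_extension_def
  by (rule sum.mono_neutral_left) (use assms in \<open>auto simp: in_keys_iff\<close>)

lemma linear_extension_module_hom:
  fixes f :: "'x \<Rightarrow> 'b"
  shows "module_hom free_scale scale (linear_extension scale f)"
proof unfold_locales
  fix p q :: "'x \<Rightarrow>\<^sub>0 'a"
  let ?A = "Poly_Mapping.keys p \<union> Poly_Mapping.keys q"
  have "Poly_Mapping.keys (p + q) \<subseteq> ?A" by (rule Poly_Mapping.keys_add)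
  then show "linear_extension scale f (p + q) = linear_extension scale f p + linear_extension scale f q"
    by (simp add: linear_extension_on_superset[of ?A] lookup_add scale_left_distrib sum.distrib)
next
  fix c and p :: "'x \<Rightarrow>\<^sub>0 'a"
  have "Poly_Mapping.keys (free_scale c p) \<subseteq> Poly_Mapping.keys p" by (auto simp: in_keys_iff)
  then show "linear_extension scale f (free_scale c p) = scale c (linear_extension scale f p)"
    by (simp add: linear_extension_on_superset[of "Poly_Mapping.keys p"] scale_sum_right)
qed

lemma linear_extension_single: "linear_extension scale f (basis_vec x) = f x"
  by (simp add: linear_extension_def)

lemma basis_vec_zero_slot: "basis_vec (xs @ [0] @ ys) \<in> free.span (multilinear_relators scale)"
proof -
  \<comment> \<open>Homogeneity with the scalar 0: the subtracted term vanishes and the slot holds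
    0.\<close>
  have "basis_vec (xs @ [scale 0 0] @ ys) - free_scale 0 (basis_vec (xs @ [0] @ ys))
      \<in> multilinear_relators scale"
    unfolding multilinear_relators_def by blast
  then show ?thesis by (auto intro: free.span_base)
qed

lemma basis_vec_sum_slot:
  "basis_vec (xs @ [\<Sum>i\<in>I. scale (c i) (x i)] @ ys) - (\<Sum>i\<in>I. free_scale (c i) (basis_vec (xs @ [x i] @ ys)))
    \<in> free.span (multilinear_relators scale)"
proof (induction I rule: infinite_finite_induct)
  case (insert j I)
  let ?b = "\<lambda>z. basis_vec (xs @ [z] @ ys) :: 'b list \<Rightarrow>\<^sub>0 'a"
  let ?s = "\<Sum>i\<in>I. scale (c i) (x i)"
  have "?b (scale (c j) (x j) + ?s) - ?b (scale (c j) (x j)) - ?b ?s \<in> multilinear_relators scale"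
    "?b (scale (c j) (x j)) - free_scale (c j) (?b (x j)) \<in> multilinear_relators scale"
    unfolding multilinear_relators_def by blast+
  then have "(?b (scale (c j) (x j) + ?s) - ?b (scale (c j) (x j)) - ?b ?s) +
      (?b (scale (c j) (x j)) - free_scale (c j) (?b (x j))) +
      (?b ?s - (\<Sum>i\<in>I. free_scale (c i) (?b (x i)))) \<in> free.span (multilinear_relators scale)"
    by (intro free.span_add[OF _ insert.IH] free.span_add free.span_base)
  then show ?case using insert.hyps by (simp add: algebra_simps)
qed (use basis_vec_zero_slot in auto)

end

context quantum_lie_algebra
begin

section \<open>Relations of the extended generators inside a tensor\<close>

definition ext_gen :: "'i option \<Rightarrow> 'u" where
  "ext_gen = case_option 1 gen"

lemma ext_gen_simps [simp]: "ext_gen None = 1" "ext_gen (Some i) = gen i"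
  by (simp_all add: ext_gen_def)

lemma ext_gen_comp_Some [simp]: "ext_gen \<circ> Some = gen"
  by (simp add: fun_eq_iff)

lemma gen_relation:
  "gen i * gen j = (\<Sum>k\<in>UNIV. \<Sum>l\<in>UNIV. scal (\<sigma> $ (i, j) $ (k, l)) (gen k * gen l)) +
     (\<Sum>k\<in>UNIV. scal (C $ (i, j) $ k) (gen k))"
proof -
  let ?ev = "linear_extension scal (\<lambda>w. prod_list (map gen w))"
  interpret ev: module_hom free_scale scal ?ev by (rule linear_extension_module_hom)
  let ?r = "basis_vec [i, j]
      - (\<Sum>k\<in>UNIV. \<Sum>l\<in>UNIV. free_scale (\<sigma> $ (i, j) $ (k, l)) (basis_vec [k, l]))
      - (\<Sum>k\<in>UNIV. free_scale (C $ (i, j) $ k) (basis_vec [k]))"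
  have "?r \<in> qla_relators \<sigma> C" unfolding qla_relators_def by blast
  then have "?ev ?r = 0" using presented hull_subset[of "qla_relators \<sigma> C" two_sided_ideal] by blast
  then show ?thesis
    by (simp add: ev.diff ev.add ev.sum ev.scale linear_extension_single algebra_simps)
qed

text \<open>The product \<open>\<chi>\<^sub>0\<chi>\<^sub>0\<close> is replaced by \<open>0\<close>: such index pairs drop out of the
  antisymmetrized sums, and the relations $\chi_A\chi_B = R^{CD}_{AB}\chi_C\chi_D$ survive.\<close>

definition ext_mult :: "'i option \<Rightarrow> 'i option \<Rightarrow> 'u" where
  "ext_mult A B = (if A = None \<and> B = None then 0 else ext_gen A * ext_gen B)"

text \<open>For two generators this is the defining relation, its C-term coming from the upper pairs
  (0, k). If exactly one index is 0, R swaps the pair and 1 commutes with the generator.\<close>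

lemma ext_mult_relation:
  "ext_mult A B = (\<Sum>p\<in>UNIV. scal (qla_R \<sigma> C $ (A, B) $ p) (ext_mult (fst p) (snd p)))"
proof -
  have "(\<Sum>p\<in>UNIV. scal (qla_R \<sigma> C $ (A, B) $ p) (ext_mult (fst p) (snd p))) =
      (\<Sum>D\<in>UNIV. \<Sum>E\<in>UNIV. scal (qla_R_entry \<sigma> C (A, B) (D, E)) (ext_mult D E))"
    unfolding UNIV_Times_UNIV[symmetric] by (subst sum.cartesian_product) (simp add: qla_R_nth case_prod_beta)
  also have "\<dots> = ext_mult A B"
  proof (cases A; cases B)
    fix i j assume "A = Some i" "B = Some j"
    then show ?thesis
      by (simp add: sum_UNIV_option qla_R_entry_def ext_mult_def gen_relation[of i j] add.commute)
  qed (simp_all add: sum_UNIV_option qla_R_entry_def ext_mult_def if_distrib[of "\<lambda>c. scal c _"] sum.delta' cong: if_cong)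
  finally show ?thesis by simp
qed

abbreviation null_tensors :: "('u list \<Rightarrow>\<^sub>0 'k) set" where
  "null_tensors \<equiv> free.span (multilinear_relators scal)"

text \<open>\<open>contracted a k Ks\<close> is the tensor of \<open>a\<close> and the generators of \<open>Ks\<close>, with the factors at the list
  positions \<open>k\<close> and \<open>k + 1\<close> of \<open>Ks\<close> multiplied. It is \<open>0\<close> if a \<open>None\<close> remains.\<close>

definition contracted :: "'u \<Rightarrow> nat \<Rightarrow> 'i option list \<Rightarrow> ('u list \<Rightarrow>\<^sub>0 'k)" where
  "contracted a k Ks =
     (if None \<in> set (take k Ks) \<or> None \<in> set (drop (Suc (Suc k)) Ks) \<or> Ks ! k = None \<and> Ks ! Suc k = None then 0
      else basis_vec (a # map ext_gen (take k Ks) @ [ext_gen (Ks ! k) * ext_gen (Ks ! Suc k)] @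
        map ext_gen (drop (Suc (Suc k)) Ks)))"

lemma contracted_append:
  assumes "length us = k"
  shows "contracted a k (us @ A # B # vs) =
    (if None \<in> set us \<or> None \<in> set vs \<or> A = None \<and> B = None then 0
     else basis_vec (a # map ext_gen us @ [ext_gen A * ext_gen B] @ map ext_gen vs))"
  using assms by (auto simp: contracted_def nth_append)

text \<open>All terms agree outside the window, so a \<open>None\<close> there removes all of them
  at once. Otherwise only the merged slot varies, and multilinearity carries the relation of
  \<open>ext_mult\<close> into it.\<close>

lemma contracted_relation:
  assumes "length us = k"
  shows "contracted a k (us @ A # B # vs) -
    (\<Sum>p\<in>UNIV. free_scale (qla_R \<sigma> C $ (A, B) $ p) (contracted a k (us @ fst p # snd p # vs)))
    \<in> null_tensors"
proof (cases "None \<in> set us \<or> None \<in> set vs")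
  case True
  then have "contracted a k (us @ A # B # vs) = 0" for A B
    using contracted_append[OF assms] by auto
  then show ?thesis by (simp add: free.span_zero)
next
  case False
  define h :: "'u \<Rightarrow> ('u list \<Rightarrow>\<^sub>0 'k)" where "h z = basis_vec ((a # map ext_gen us) @ [z] @ map ext_gen vs)" for z
  \<comment> \<open>The two tensors differ only for \<open>A = B = None\<close>, where
    \<open>h 0\<close> has a zero slot and is therefore null.\<close>
  have eq: "contracted a k (us @ A # B # vs) - h (ext_mult A B) \<in> null_tensors" for A B
    using False basis_vec_zero_slot[of "a # map ext_gen us" "map ext_gen vs"]
    by (auto simp: contracted_append[OF assms] h_def ext_mult_def free.span_zero free.span_neg)
  let ?R = "\<lambda>p. qla_R \<sigma> C $ (A, B) $ p"
  have rel: "h (ext_mult A B) - (\<Sum>p\<in>UNIV. free_scale (?R p) (h (ext_mult (fst p) (snd p)))) \<in> null_tensors"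
    unfolding h_def by (subst ext_mult_relation) (rule basis_vec_sum_slot)
  have "(\<Sum>p\<in>UNIV. free_scale (?R p) (contracted a k (us @ fst p # snd p # vs) - h (ext_mult (fst p) (snd p)))) \<in> null_tensors"
    by (intro free.span_sum free.span_scale eq)
  from free.span_diff[OF free.span_add[OF eq[of A B] rel] this]
  show ?thesis by (simp add: free.scale_right_diff_distrib sum_subtractf)
qed

text \<open>The rows of \<open>Y * (1 - R_k)\<close> are combinations of rows of 1 - R_k, and each
  of those is an instance of \<open>contracted_relation\<close>.\<close>

lemma contracted_antisym:
  assumes "Suc k < length Is"
  shows "(\<Sum>Ks | length Ks = length Is.
      free_scale (entry (Y * (1 - braid_op (qla_R \<sigma> C) k)) Is Ks) (contracted a k Ks)) \<in> null_tensors"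
proof -
  let ?r = "braid_op (qla_R \<sigma> C) k" and ?n = "length Is"
  have inner: "(\<Sum>Ks | length Ks = ?n. free_scale (entry (1 - ?r) Js Ks) (contracted a k Ks)) \<in> null_tensors"
    if "length Js = ?n" for Js
  proof -
    define us A B vs where "us = take k Js" "A = Js ! k" "B = Js ! Suc k" "vs = drop (Suc (Suc k)) Js"
    have Js: "Js = us @ A # B # vs" and us: "length us = k"
      using list_split2[of k Js] that assms unfolding us_A_B_vs_def by auto
    have "(\<Sum>Ks | length Ks = ?n. free_scale (entry (1 - ?r) Js Ks) (contracted a k Ks)) =
        (\<Sum>Ks | length Ks = ?n. free_scale (entry 1 Js Ks) (contracted a k Ks)) -
        (\<Sum>Ks | length Ks = ?n. free_scale (entry ?r Js Ks) (contracted a k Ks))"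
      by (simp add: free.scale_left_diff_distrib sum_subtractf)
    also have "(\<Sum>Ks | length Ks = ?n. free_scale (entry 1 Js Ks) (contracted a k Ks)) = contracted a k Js"
      using that by (simp add: entry_one if_distrib[of "\<lambda>c. free_scale c _"] sum.delta' finite_lists_of_length cong: if_cong)
    also have "(\<Sum>Ks | length Ks = ?n. free_scale (entry ?r Js Ks) (contracted a k Ks)) =
        (\<Sum>p\<in>UNIV. free_scale (qla_R \<sigma> C $ (A, B) $ p) (contracted a k (us @ fst p # snd p # vs)))"
      unfolding that[symmetric] unfolding Js by (rule sum_braid_op[OF us]) simp
    finally show ?thesis using contracted_relation[OF us] Js by simp
  qed
  have "(\<Sum>Ks | length Ks = ?n. free_scale (entry (Y * (1 - ?r)) Is Ks) (contracted a k Ks)) =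
      (\<Sum>Ks | length Ks = ?n. \<Sum>Js | length Js = ?n. free_scale (entry Y Is Js) (free_scale (entry (1 - ?r) Js Ks) (contracted a k Ks)))"
    by (simp only: entry_times free.scale_sum_left free.scale_scale)
  also have "\<dots> = (\<Sum>Js | length Js = ?n. free_scale (entry Y Is Js)
      (\<Sum>Ks | length Ks = ?n. free_scale (entry (1 - ?r) Js Ks) (contracted a k Ks)))"
    by (subst sum.swap) (simp only: free.scale_sum_right)
  also have "\<dots> \<in> null_tensors"
    by (intro free.span_sum free.span_scale inner) simp
  finally show ?thesis .
qed

text \<open>Upper multi-indices of this form carry the entries D of the overview; \<open>p\<close>
  counts from 0, so \<open>p = 0\<close> belongs to D_1.\<close>

definition insert_None :: "nat \<Rightarrow> 'i list \<Rightarrow> 'i option list" where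
  "insert_None p ls = map Some (take p ls) @ None # map Some (drop p ls)"

text \<open>\<open>contracted\<close> keeps no multi-index with two \<open>None\<close>, and a
  single one only at \<open>k\<close> or \<open>Suc k\<close>, where it multiplies the neighbouring
  generator by 1.\<close>

lemma contracted_sum:
  assumes "Suc k < n"
  shows "(\<Sum>Ks | length Ks = n. free_scale (c Ks) (contracted a k Ks)) =
    (\<Sum>ks | length ks = n. free_scale (c (map Some ks)) (contracted a k (map Some ks))) +
    ((\<Sum>ls | length ls = n - 1. free_scale (c (insert_None k ls)) (basis_vec (a # map gen ls))) +
     (\<Sum>ls | length ls = n - 1. free_scale (c (insert_None (Suc k) ls)) (basis_vec (a # map gen ls))))"
proof -
  let ?F = "\<lambda>Ks. free_scale (c Ks) (contracted a k Ks)"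
  define S where "S = map Some ` {ks :: 'i list. length ks = n}"
  define T where "T p = insert_None p ` {ls. length ls = n - 1}" for p
  have fin: "finite S" "finite (T p)" for p
    unfolding S_def T_def by (simp_all add: finite_lists_of_length)
  have len: "length (insert_None p ls) = Suc (length ls)" if "p \<le> length ls" for p ls
    using that by (simp add: insert_None_def)
  have nth: "insert_None p ls ! q = None \<longleftrightarrow> q = p" if "p \<le> length ls" "q \<le> length ls" for p q ls
    using that by (auto simp: insert_None_def nth_append nth_Cons split: nat.splits)
  have inj: "inj_on (insert_None p) {ls. length ls = n - 1}" if "p < n" for p
  proof (rule inj_onI)
    fix ls ls' assume *: "ls \<in> {ls. length ls = n - 1}" "ls' \<in> {ls. length ls = n - 1}"
      "insert_None p ls = insert_None p ls'"
    then have "take p ls = take p ls' \<and> drop p ls = drop p ls'"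
      using that by (auto simp: insert_None_def inj_map_eq_map)
    then show "ls = ls'" by (metis append_take_drop_id)
  qed
  have notin: "S \<inter> (T k \<union> T (Suc k)) = {}" "T k \<inter> T (Suc k) = {}"
  proof -
    have "None \<in> set Ks" if "Ks \<in> T p" for Ks p using that unfolding T_def insert_None_def by auto
    moreover have "None \<notin> set Ks" if "Ks \<in> S" for Ks using that unfolding S_def by auto
    ultimately show "S \<inter> (T k \<union> T (Suc k)) = {}" by blast
    have "Ks ! k = None" if "Ks \<in> T k" for Ks using that nth[of k _ k] assms unfolding T_def by auto
    moreover have "Ks ! k \<noteq> None" if "Ks \<in> T (Suc k)" for Ks
      using that nth[of "Suc k" _ k] assms unfolding T_def by auto
    ultimately show "T k \<inter> T (Suc k) = {}" by blast
  qed
  have sum_T: "sum ?F (T p) = (\<Sum>ls | length ls = n - 1. free_scale (c (insert_None p ls)) (basis_vec (a # map gen ls)))"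
    if p: "p = k \<or> p = Suc k" for p
  proof -
    have "contracted a k (insert_None p ls) = basis_vec (a # map gen ls)" if "length ls = n - 1" for ls
    proof -
      have k: "k < length ls" using that assms by simp
      then have split: "ls = take k ls @ ls ! k # drop (Suc k) ls" by (rule id_take_nth_drop)
      have "insert_None k ls = map Some (take k ls) @ None # Some (ls ! k) # map Some (drop (Suc k) ls)"
        "insert_None (Suc k) ls = map Some (take k ls) @ Some (ls ! k) # None # map Some (drop (Suc k) ls)"
        using k by (simp_all add: insert_None_def Cons_nth_drop_Suc[symmetric] take_Suc_conv_app_nth)
      moreover have "a # map gen ls = a # map gen (take k ls) @ gen (ls ! k) # map gen (drop (Suc k) ls)"
        by (subst split) simp
      ultimately show ?thesis
        using p k by (auto simp: contracted_append)
    qed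
    moreover have "inj_on (insert_None p) {ls. length ls = n - 1}" using inj p assms by auto
    ultimately show ?thesis unfolding T_def by (auto simp: sum.reindex intro!: sum.cong)
  qed
  have "(\<Sum>Ks | length Ks = n. ?F Ks) = sum ?F (S \<union> (T k \<union> T (Suc k)))"
  proof (rule sum.mono_neutral_right)
    show "S \<union> (T k \<union> T (Suc k)) \<subseteq> {Ks. length Ks = n}"
      using assms unfolding S_def T_def by (auto simp: len)
    show "\<forall>Ks\<in>{Ks. length Ks = n} - (S \<union> (T k \<union> T (Suc k))). ?F Ks = 0"
    proof
      fix Ks assume Ks: "Ks \<in> {Ks. length Ks = n} - (S \<union> (T k \<union> T (Suc k)))"
      have "contracted a k Ks = 0"
      proof (rule ccontr)
        assume nz: "contracted a k Ks \<noteq> 0"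
        define us A B vs where "us = take k Ks" "A = Ks ! k" "B = Ks ! Suc k" "vs = drop (Suc (Suc k)) Ks"
        have eq: "Ks = us @ A # B # vs" and us: "length us = k"
          using list_split2[of k Ks] Ks assms unfolding us_A_B_vs_def by auto
        have "None \<notin> set us" "None \<notin> set vs" and AB: "A \<noteq> None \<or> B \<noteq> None"
          using nz unfolding eq contracted_append[OF us] by (auto split: if_splits)
        then obtain us' vs' where uv: "us = map Some us'" "vs = map Some vs'" by (metis list_without_None)
        have l: "length us' = k" "length us' + length vs' + 2 = n" using us uv eq Ks by auto
        consider i j where "A = Some i" "B = Some j" | j where "A = None" "B = Some j" | i where "A = Some i" "B = None"
          using AB by (cases A; cases B) auto
        then show False
        proof cases
          case 1
          then have "Ks = map Some (us' @ i # j # vs')" using eq uv by simp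
          moreover have "us' @ i # j # vs' \<in> {ks. length ks = n}" using l by simp
          ultimately show False using Ks unfolding S_def by blast
        next
          case 2
          then have "Ks = insert_None k (us' @ j # vs')" using eq uv l by (simp add: insert_None_def)
          moreover have "us' @ j # vs' \<in> {ks. length ks = n - 1}" using l by auto
          ultimately show False using Ks unfolding T_def by blast
        next
          case 3
          then have "Ks = insert_None (Suc k) (us' @ i # vs')" using eq uv l by (simp add: insert_None_def)
          moreover have "us' @ i # vs' \<in> {ks. length ks = n - 1}" using l by auto
          ultimately show False using Ks unfolding T_def by blast
        qed
      qed
      then show "?F Ks = 0" by simp
    qed
  qed (rule finite_lists_of_length)
  also have "\<dots> = sum ?F S + (sum ?F (T k) + sum ?F (T (Suc k)))"
    using notin fin by (simp add: sum.union_disjoint)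
  also have "sum ?F S = (\<Sum>ks | length ks = n. ?F (map Some ks))"
    unfolding S_def by (simp add: sum.reindex inj_map_Some)
  finally show ?thesis by (simp only: sum_T simp_thms)
qed

text \<open>The lower end carries the sign (-1)^m of the summand in which \<open>a\<close> absorbs
  the first generator; this lets the two be joined into one chain.\<close>

lemma alternating_telescope:
  "(\<Sum>k<m. free_scale ((-1) ^ (m - 1 - k)) (E k + E (Suc k))) = E m - free_scale ((-1) ^ m) (E 0)"
proof (induction m)
  case (Suc m)
  have "(\<Sum>k<m. free_scale ((-1) ^ (m - k)) (E k + E (Suc k))) =
      - (\<Sum>k<m. free_scale ((-1) ^ (m - 1 - k)) (E k + E (Suc k)))"
    unfolding sum_negf[symmetric]
  proof (intro sum.cong refl)
    fix k assume "k \<in> {..<m}"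
    then have "m - k = Suc (m - 1 - k)" by simp
    then show "free_scale ((-1) ^ (m - k)) (E k + E (Suc k)) = - free_scale ((-1) ^ (m - 1 - k)) (E k + E (Suc k))"
      by (simp only: power_Suc) simp
  qed
  then show ?case using Suc.IH by simp
qed simp

text \<open>As \<open>a\<close> heads the list, the boundary index k + 2 merges the places k and k +
  1 of \<open>ks\<close>, with sign exponent (m + 1) - (k + 2).\<close>

lemma bar_boundary_basis_gen:
  assumes "length ks = Suc m"
  shows "bar_boundary_basis (a # map gen ks) =
    free_scale ((-1) ^ m) (basis_vec (a * gen (hd ks) # map gen (tl ks))) +
    (\<Sum>k<m. free_scale ((-1) ^ (m - 1 - k)) (contracted a k (map Some ks)))"
proof -
  let ?f = "\<lambda>i. free_scale ((-1) ^ (Suc m - i)) (basis_vec (mult_at i (a # map gen ks)))"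
  obtain j js where ks: "ks = j # js" using assms by (cases ks) auto
  have "bar_boundary_basis (a # map gen ks) = (\<Sum>i=1..Suc m. ?f i)"
    using assms by (simp add: bar_boundary_basis_def)
  also have "\<dots> = ?f 1 + (\<Sum>i=Suc 1..Suc m. ?f i)" by (rule sum.atLeast_Suc_atMost) simp
  also have "(\<Sum>i=Suc 1..Suc m. ?f i) = (\<Sum>k<m. ?f (Suc (Suc k)))"
    by (simp only: sum.shift_bounds_cl_Suc_ivl One_nat_def sum.atLeast1_atMost_eq)
  also have "\<dots> = (\<Sum>k<m. free_scale ((-1) ^ (m - 1 - k)) (contracted a k (map Some ks)))"
  proof (intro sum.cong refl)
    fix k assume "k \<in> {..<m}"
    then have k: "Suc k < length ks" using assms by simp
    have "mult_at (Suc (Suc k)) (a # map gen ks) =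
        a # map gen (take k ks) @ [gen (ks ! k) * gen (ks ! Suc k)] @ map gen (drop (Suc (Suc k)) ks)"
      using k by (simp add: mult_at_def take_map drop_map)
    moreover have "contracted a k (map Some ks) = basis_vec (a # map gen (take k ks) @
        [gen (ks ! k) * gen (ks ! Suc k)] @ map gen (drop (Suc (Suc k)) ks))"
      using k by (auto simp: contracted_def take_map drop_map comp_def)
    ultimately show "?f (Suc (Suc k)) = free_scale ((-1) ^ (m - 1 - k)) (contracted a k (map Some ks))"
      by simp
  qed
  also have "?f 1 = free_scale ((-1) ^ m) (basis_vec (a * gen (hd ks) # map gen (tl ks)))"
    by (simp add: mult_at_def ks)
  finally show ?thesis .
qed

end

context quantum_lie_algebra
begin

section \<open>The boundary of a q-antisymmetric chain\<close>

definition antisym_reps :: "nat \<Rightarrow> ('u list \<Rightarrow>\<^sub>0 'k) set" where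
  "antisym_reps m = {antisym_rep \<sigma> gen a is | a is. length is = m}"

text \<open>Equality can only hold up to null tensors, since the relations of the algebra are
  applied inside one slot of a representative.\<close>

lemma bar_boundary_antisym_rep:
  assumes len: "length is = Suc m"
  shows "\<exists>v\<in>free.span (antisym_reps m).
    linear_extension free_scale bar_boundary_basis (antisym_rep \<sigma> gen a is) - v \<in> null_tensors"
proof -
  interpret L: module_hom free_scale free_scale "linear_extension free_scale bar_boundary_basis"
    by (rule module_hom_linear_extension)
  define c where "c = entry (antisym_elem (braid_op (qla_R \<sigma> C)) m) (map Some is)"
  define E where "E p = (\<Sum>ls | length ls = m. free_scale (c (insert_None p ls)) (basis_vec (a # map gen ls)))" for p
  define U where "U k = (\<Sum>ks | length ks = Suc m. free_scale (c (map Some ks)) (contracted a k (map Some ks)))" for k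
  define F where "F = (\<Sum>ks | length ks = Suc m. free_scale (c (map Some ks)) (basis_vec (a * gen (hd ks) # map gen (tl ks))))"
  \<comment> \<open>\<open>F\<close> collects the first upper indices 1, ..., N and
    \<open>E 0\<close> the index 0, with \<open>a * 1 = a\<close>. The boundary turns out to be
    (-1)^m \<open>v\<close>.\<close>
  define v where "v = F + E 0"
  have c: "antisymmetrizer (Suc m) \<sigma> (Suc m) is ks = c (map Some ks)" for ks
    unfolding c_def antisym_qla_R(2) using antisymmetrizer_eq_entry[OF len, of \<sigma> ks] by simp
  have boundary: "linear_extension free_scale bar_boundary_basis (antisym_rep \<sigma> gen a is) =
      free_scale ((-1) ^ m) F + (\<Sum>k<m. free_scale ((-1) ^ (m - 1 - k)) (U k))"
  proof -
    have "linear_extension free_scale bar_boundary_basis (antisym_rep \<sigma> gen a is) =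
        (\<Sum>ks | length ks = Suc m. free_scale (c (map Some ks)) (bar_boundary_basis (a # map gen ks)))"
      by (simp add: antisym_rep_def len Let_def L.sum L.scale c del: antisymmetrizer.simps)
    also have "\<dots> = (\<Sum>ks | length ks = Suc m. free_scale ((-1) ^ m) (free_scale (c (map Some ks))
          (basis_vec (a * gen (hd ks) # map gen (tl ks)))) +
        (\<Sum>k<m. free_scale ((-1) ^ (m - 1 - k)) (free_scale (c (map Some ks)) (contracted a k (map Some ks)))))"
      by (intro sum.cong refl)
        (simp add: bar_boundary_basis_gen free.scale_right_distrib free.scale_sum_right mult.commute)
    also have "\<dots> = free_scale ((-1) ^ m) F + (\<Sum>k<m. free_scale ((-1) ^ (m - 1 - k)) (U k))"
      unfolding sum.distrib F_def U_def free.scale_sum_right by (subst (2) sum.swap) (rule refl)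
    finally show ?thesis .
  qed
  have UE: "U k + (E k + E (Suc k)) \<in> null_tensors" if k: "k < m" for k
  proof -
    obtain Y where Y: "antisym_elem (braid_op (qla_R \<sigma> C)) m = Y * (1 - braid_op (qla_R \<sigma> C) k)"
      using antisym_right_factor[OF braided_braid_op[OF yang_baxter_R] k] by blast
    have "(\<Sum>Ks | length Ks = Suc m. free_scale (c Ks) (contracted a k Ks)) \<in> null_tensors"
      using contracted_antisym[of k "map Some is" Y a] k len unfolding c_def Y by simp
    then show ?thesis
      unfolding contracted_sum[of k "Suc m" c a, OF Suc_mono[OF k]] U_def E_def by simp
  qed
  have E_last: "E m = 0"
    unfolding E_def c_def
    by (intro sum.neutral ballI, subst antisym_qla_R_None) (auto simp: len insert_None_def nth_append)
  have "(\<Sum>k<m. free_scale ((-1) ^ (m - 1 - k)) (U k + (E k + E (Suc k)))) \<in> null_tensors"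
    by (intro free.span_sum free.span_scale UE) simp
  then have "(\<Sum>k<m. free_scale ((-1) ^ (m - 1 - k)) (U k)) - free_scale ((-1) ^ m) (E 0) \<in> null_tensors"
    using alternating_telescope[of m E] E_last by (simp add: free.scale_right_distrib sum.distrib)
  then have "linear_extension free_scale bar_boundary_basis (antisym_rep \<sigma> gen a is) - free_scale ((-1) ^ m) v \<in> null_tensors"
    unfolding boundary v_def by (simp add: free.scale_right_distrib)
  moreover have "v \<in> free.span (antisym_reps m)"
  proof -
    obtain G where G: "\<And>J ks. length ks = m \<Longrightarrow>
        c (J # map Some ks) = (\<Sum>js | length js = m. G J js * antisymmetrizer m \<sigma> m js ks)"
      using antisym_qla_R_factor[OF yang_baxter_R, of m "map Some is"] unfolding c_def by blast
    have "{ks :: 'i list. length ks = Suc m} = (\<lambda>(j, ls). j # ls) ` (UNIV \<times> {ls. length ls = m})"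
      by (auto simp: length_Suc_conv image_iff)
    then have "F = (\<Sum>(j, ls)\<in>UNIV \<times> {ls. length ls = m}.
        free_scale (c (Some j # map Some ls)) (basis_vec (a * gen j # map gen ls)))"
      unfolding F_def by (subst sum.reindex_cong[where l = "\<lambda>(j, ls). j # ls"]) (auto simp: inj_on_def)
    also have "\<dots> = (\<Sum>j\<in>UNIV. \<Sum>ls | length ls = m.
        free_scale (c (Some j # map Some ls)) (basis_vec (a * gen j # map gen ls)))"
      by (rule sum.cartesian_product[symmetric])
    finally have "v = (\<Sum>J\<in>UNIV. \<Sum>ls | length ls = m.
        free_scale (c (J # map Some ls)) (basis_vec (a * ext_gen J # map gen ls)))"
      unfolding v_def E_def by (simp add: sum_UNIV_option insert_None_def add.commute)
    also have "\<dots> = (\<Sum>J\<in>UNIV. \<Sum>ls | length ls = m. \<Sum>js | length js = m. free_scale (G J js)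
        (free_scale (antisymmetrizer m \<sigma> m js ls) (basis_vec (a * ext_gen J # map gen ls))))"
      by (intro sum.cong refl) (simp add: G free.scale_sum_left)
    also have "\<dots> = (\<Sum>J\<in>UNIV. \<Sum>js | length js = m. free_scale (G J js) (antisym_rep \<sigma> gen (a * ext_gen J) js))"
    proof (rule sum.cong[OF refl])
      fix J
      show "(\<Sum>ls | length ls = m. \<Sum>js | length js = m. free_scale (G J js)
          (free_scale (antisymmetrizer m \<sigma> m js ls) (basis_vec (a * ext_gen J # map gen ls)))) =
        (\<Sum>js | length js = m. free_scale (G J js) (antisym_rep \<sigma> gen (a * ext_gen J) js))"
        by (subst sum.swap) (simp add: antisym_rep_def Let_def free.scale_sum_right)
    qed
    also have "\<dots> \<in> free.span (antisym_reps m)"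
      by (intro free.span_sum free.span_scale free.span_base) (auto simp: antisym_reps_def)
    finally show ?thesis .
  qed
  ultimately show ?thesis by (blast intro: free.span_scale)
qed

end

section \<open>Subspaces of the tensor algebra\<close>

lemma tensor_coset_self: "v \<in> tensor_coset scal v"
  by (simp add: tensor_coset_def free.span_zero)

lemma tensor_add_coset:
  "tensor_add scal (tensor_coset scal v) (tensor_coset scal w) = tensor_coset scal (v + w)"
proof -
  have "tensor_coset scal (x + y) = tensor_coset scal (v + w)"
    if "x \<in> tensor_coset scal v" "y \<in> tensor_coset scal w" for x y
    using free.span_add[of "x - v" "multilinear_relators scal" "y - w"] that
    unfolding tensor_coset_eq_iff by (simp add: tensor_coset_def algebra_simps)
  then show ?thesis
    unfolding tensor_add_def using tensor_coset_self[of v scal] tensor_coset_self[of w scal] by blast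
qed

lemma tensor_scale_coset:
  "tensor_scale scal c (tensor_coset scal v) = tensor_coset scal (free_scale c v)"
proof -
  have "tensor_coset scal (free_scale c x) = tensor_coset scal (free_scale c v)"
    if "x \<in> tensor_coset scal v" for x
    using free.span_scale[of "x - v" "multilinear_relators scal" c] that
    unfolding tensor_coset_eq_iff by (simp add: tensor_coset_def free.scale_right_diff_distrib)
  then show ?thesis
    unfolding tensor_scale_def using tensor_coset_self[of v scal] by blast
qed

lemma tensor_subspace_image:
  assumes "free.subspace V"
  shows "tensor_subspace scal (tensor_coset scal ` V)"
  using free.subspace_0[OF assms] free.subspace_add[OF assms] free.subspace_scale[OF assms]
  unfolding tensor_subspace_def by (auto simp: tensor_add_coset tensor_scale_coset)

lemma subspace_tensor_coset_vimage:
  assumes "tensor_subspace scal T"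
  shows "free.subspace {v. tensor_coset scal v \<in> T}"
  using assms unfolding tensor_subspace_def free.subspace_def
  by (auto simp flip: tensor_add_coset tensor_scale_coset)

text \<open>Images and preimages of subspaces under the coset map are subspaces, so spans of tensors
  can be computed on representatives.\<close>

lemma tensor_span_image: "tensor_span scal (tensor_coset scal ` B) = tensor_coset scal ` free.span B"
  unfolding tensor_span_def
proof (rule hull_unique)
  fix T assume T: "tensor_coset scal ` B \<subseteq> T" "tensor_subspace scal T"
  have "free.span B \<subseteq> {v. tensor_coset scal v \<in> T}"
    using T(1) by (intro free.span_minimal subspace_tensor_coset_vimage T(2)) auto
  then show "tensor_coset scal ` free.span B \<subseteq> T" by blast
qed (auto intro: free.span_base tensor_subspace_image free.subspace_span)

lemma subspace_homogeneous: "free.subspace {v. \<forall>xs\<in>Poly_Mapping.keys v. length xs = n}"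
  unfolding free.subspace_def by (fastforce simp: in_keys_iff lookup_add)

section \<open>The bar complex\<close>

lemma mult_at_append: "i = Suc (length us) \<Longrightarrow> mult_at i (us @ a # b # vs) = us @ (a * b) # vs"
  by (simp add: mult_at_def nth_append)

lemma length_mult_at: "1 \<le> i \<Longrightarrow> i < length as \<Longrightarrow> length (mult_at i as) = length as - 1"
  by (simp add: mult_at_def)

text \<open>The presimplicial identity of the bar construction: associativity for
  \<open>i = j\<close>, and otherwise two multiplications at disjoint places.\<close>

lemma mult_at_mult_at:
  fixes as :: "'u::semigroup_mult list"
  assumes "1 \<le> i" "i \<le> j" "Suc j < length as"
  shows "mult_at j (mult_at i as) = mult_at i (mult_at (Suc j) as)"
proof -
  define k where "k = i - 1"
  have i: "i = Suc k" using assms by (simp add: k_def)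
  define us a b xs where "us = take k as" "a = as ! k" "b = as ! Suc k" "xs = drop (Suc (Suc k)) as"
  have as: "as = us @ a # b # xs" and us: "length us = k"
    using list_split2[of k as] assms i unfolding us_a_b_xs_def by auto
  show ?thesis
  proof (cases "i = j")
    case True
    then obtain c vs where "xs = c # vs" using assms as us i by (cases xs) auto
    then show ?thesis
      using mult_at_append[of i us a b "c # vs"] mult_at_append[of "Suc i" "us @ [a]" b c vs]
        mult_at_append[of i us "a * b" c vs] mult_at_append[of i us a "b * c" vs]
      unfolding as by (simp add: us i True[symmetric] mult.assoc)
  next
    case False
    define l where "l = j - Suc i"
    have j: "j = Suc (Suc (k + l))" using False assms i unfolding l_def by simp
    define vs c d ws where "vs = take l xs" "c = xs ! l" "d = xs ! Suc l" "ws = drop (Suc (Suc l)) xs"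
    have xs: "xs = vs @ c # d # ws" and vs: "length vs = l"
      using list_split2[of l xs] assms as us j unfolding vs_c_d_ws_def by auto
    show ?thesis
      using mult_at_append[of i us a b "vs @ c # d # ws"] mult_at_append[of "Suc j" "us @ a # b # vs" c d ws]
        mult_at_append[of j "us @ (a * b) # vs" c d ws] mult_at_append[of i us a b "vs @ (c * d) # ws"]
      unfolding as xs by (simp add: us vs i j)
  qed
qed

lemma bar_boundary_bar_boundary_basis:
  fixes as :: "'u::ring_1 list"
  shows "linear_extension free_scale bar_boundary_basis (bar_boundary_basis as :: 'u list \<Rightarrow>\<^sub>0 'k::field) = 0"
proof -
  interpret L: module_hom free_scale free_scale
      "linear_extension free_scale bar_boundary_basis :: ('u list \<Rightarrow>\<^sub>0 'k) \<Rightarrow> ('u list \<Rightarrow>\<^sub>0 'k)"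
    by (rule module_hom_linear_extension)
  define n where "n = length as - 1"
  define g :: "nat \<times> nat \<Rightarrow> 'u list \<Rightarrow>\<^sub>0 'k" where
    "g = (\<lambda>(i, j). free_scale ((-1) ^ (n - i) * (-1) ^ (n - 1 - j)) (basis_vec (mult_at j (mult_at i as))))"
  define P Q where "P = {(i, j). 1 \<le> i \<and> i \<le> j \<and> j \<le> n - 1}" and "Q = {(i, j). 1 \<le> j \<and> j < i \<and> i \<le> n}"
  have "linear_extension free_scale bar_boundary_basis (bar_boundary_basis as :: 'u list \<Rightarrow>\<^sub>0 'k) =
      (\<Sum>i=1..n. free_scale ((-1) ^ (n - i)) (bar_boundary_basis (mult_at i as)))"
    by (simp add: bar_boundary_basis_def[of as] Let_def n_def L.sum L.scale)
  also have "\<dots> = (\<Sum>i=1..n. \<Sum>j=1..n - 1. g (i, j))"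
  proof (intro sum.cong refl)
    fix i assume "i \<in> {1..n}"
    then have "length (mult_at i as) = n" by (subst length_mult_at) (auto simp: n_def)
    then show "free_scale ((-1) ^ (n - i)) (bar_boundary_basis (mult_at i as)) = (\<Sum>j=1..n - 1. g (i, j))"
      by (simp add: bar_boundary_basis_def Let_def free.scale_sum_right g_def)
  qed
  also have "\<dots> = sum g ({1..n} \<times> {1..n - 1})"
    by (simp add: sum.cartesian_product)
  also have "{1..n} \<times> {1..n - 1} = P \<union> Q"
    unfolding P_def Q_def by auto
  also have "sum g (P \<union> Q) = sum g P + sum g Q"
  proof (rule sum.union_disjoint)
    have "P \<subseteq> {..n} \<times> {..n}" "Q \<subseteq> {..n} \<times> {..n}" unfolding P_def Q_def by auto
    then show "finite P" "finite Q" by (auto intro: finite_subset)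
    show "P \<inter> Q = {}" unfolding P_def Q_def by auto
  qed
  \<comment> \<open>The pair (i, j) with j < i performs the same two multiplications as (j, i - 1),
    and the sign exponents differ by one in total.\<close>
  also have "sum g Q = (\<Sum>x\<in>P. - g x)"
  proof (rule sum.reindex_bij_witness[of _ "\<lambda>(i, j). (Suc j, i)" "\<lambda>(i, j). (j, i - 1)"])
    fix x assume "x \<in> Q"
    then obtain i j where x: "x = (Suc i, j)" and ij: "1 \<le> j" "j \<le> i" "Suc i \<le> n"
      unfolding Q_def by (cases x, case_tac a) auto
    show "(case case x of (i, j) \<Rightarrow> (j, i - 1) of (i, j) \<Rightarrow> (Suc j, i)) = x"
      "(case x of (i, j) \<Rightarrow> (j, i - 1)) \<in> P"
      using ij unfolding x P_def by auto
    have "mult_at i (mult_at j as) = mult_at j (mult_at (Suc i) as)"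
      using ij by (intro mult_at_mult_at) (auto simp: n_def)
    moreover have "n - j = Suc (n - 1 - j)" using ij by simp
    then have "(-1 :: 'k) ^ (n - j) = - ((-1) ^ (n - 1 - j))" by simp
    ultimately show "- g (case x of (i, j) \<Rightarrow> (j, i - 1)) = g x"
      unfolding x g_def by (simp add: mult.commute)
  qed (auto simp: P_def Q_def)
  finally show ?thesis by (simp add: sum_negf)
qed

lemma bar_boundary_bar_boundary:
  "linear_extension free_scale bar_boundary_basis (linear_extension free_scale bar_boundary_basis v) = 0"
proof -
  interpret L: module_hom free_scale free_scale "linear_extension free_scale bar_boundary_basis"
    by (rule module_hom_linear_extension)
  show ?thesis
    unfolding linear_extension_def[of free_scale bar_boundary_basis v] L.sum L.scale
      bar_boundary_bar_boundary_basis by simp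
qed

lemma keys_bar_boundary_basis:
  assumes "length as = Suc n" "xs \<in> Poly_Mapping.keys (bar_boundary_basis as :: 'u::ring_1 list \<Rightarrow>\<^sub>0 'k::field)"
  shows "length xs = n"
proof -
  have "bar_boundary_basis as \<in> {v :: 'u list \<Rightarrow>\<^sub>0 'k. \<forall>xs\<in>Poly_Mapping.keys v. length xs = n}"
    unfolding bar_boundary_basis_def Let_def
    using assms(1)
    by (intro free.subspace_sum[OF subspace_homogeneous] free.subspace_scale[OF subspace_homogeneous])
      (auto simp: length_mult_at)
  then show ?thesis using assms(2) by blast
qed

context k_algebra
begin

text \<open>Leaves only closure to be checked for both complexes. It is asked of the coset, not of
  the representative, because the boundary of an antisymmetric representative lies in the span only
  modulo null tensors.\<close>

lemma is_chain_complex_cosets: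
  assumes K: "\<And>n. n \<ge> 1 \<Longrightarrow> K n = tensor_coset scal ` V n"
    and sub: "\<And>n. n \<ge> 1 \<Longrightarrow> free.subspace (V n)"
    and closed: "\<And>n v. n \<ge> 1 \<Longrightarrow> v \<in> V (Suc n) \<Longrightarrow>
      tensor_coset scal (linear_extension free_scale bar_boundary_basis v) \<in> K n"
  shows "is_chain_complex scal K (bar_boundary scal)"
proof -
  interpret L: module_hom free_scale free_scale "linear_extension free_scale bar_boundary_basis"
    by (rule module_hom_linear_extension)
  show ?thesis
    unfolding is_chain_complex_def
  proof (intro conjI allI impI ballI)
    fix n :: nat assume n: "n \<ge> 1"
    show "tensor_subspace scal (K n)" unfolding K[OF n] by (rule tensor_subspace_image[OF sub[OF n]])
    show "bar_boundary scal ` K (n + 1) \<subseteq> K n"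
      using closed[OF n] by (auto simp: K[of "Suc n"] bar_boundary_tensor_coset)
    show "bar_boundary scal (tensor_add scal X Y) = tensor_add scal (bar_boundary scal X) (bar_boundary scal Y)"
      if "X \<in> K (n + 1)" "Y \<in> K (n + 1)" for X Y
      using that by (auto simp: K[of "Suc n"] tensor_add_coset bar_boundary_tensor_coset L.add)
    show "bar_boundary scal (tensor_scale scal c X) = tensor_scale scal c (bar_boundary scal X)"
      if "X \<in> K (n + 1)" for X c
      using that by (auto simp: K[of "Suc n"] tensor_scale_coset bar_boundary_tensor_coset L.scale)
    show "bar_boundary scal (bar_boundary scal X) = tensor_coset scal 0" if "X \<in> K (n + 2)" for X
      using that by (auto simp: K[of "Suc (Suc n)"] bar_boundary_tensor_coset bar_boundary_bar_boundary)
  qed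
qed

lemma is_chain_complex_tensor_power: "is_chain_complex scal (tensor_power scal) (bar_boundary scal)"
proof (rule is_chain_complex_cosets)
  show "tensor_power scal n = tensor_coset scal ` {v. \<forall>xs\<in>Poly_Mapping.keys v. length xs = n}" for n
    by (rule tensor_power_def)
  fix n and v :: "'u list \<Rightarrow>\<^sub>0 'k" assume "v \<in> {v. \<forall>xs\<in>Poly_Mapping.keys v. length xs = Suc n}"
  then have "linear_extension free_scale bar_boundary_basis v \<in> {v. \<forall>xs\<in>Poly_Mapping.keys v. length xs = n}"
    unfolding linear_extension_def[of free_scale bar_boundary_basis v]
    by (intro free.subspace_sum[OF subspace_homogeneous] free.subspace_scale[OF subspace_homogeneous])
      (auto intro: keys_bar_boundary_basis)
  then show "tensor_coset scal (linear_extension free_scale bar_boundary_basis v) \<in> tensor_power scal n"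
    unfolding tensor_power_def by (rule imageI)
qed (rule subspace_homogeneous)

end

context quantum_lie_algebra
begin

lemma antisym_chains_eq: "antisym_chains scal \<sigma> gen (Suc m) = tensor_coset scal ` free.span (antisym_reps m)"
proof -
  have "{tensor_coset scal (antisym_rep \<sigma> gen a is) | a is. length is + 1 = Suc m} = tensor_coset scal ` antisym_reps m"
    unfolding antisym_reps_def by auto
  then show ?thesis unfolding antisym_chains_def by (simp add: tensor_span_image)
qed

lemma antisym_chains_subset_tensor_power: "antisym_chains scal \<sigma> gen (Suc m) \<subseteq> tensor_power scal (Suc m)"
proof -
  have "antisym_rep \<sigma> gen a is \<in> {v. \<forall>xs\<in>Poly_Mapping.keys v. length xs = Suc m}"
    if "length is = m" for a "is"
    unfolding antisym_rep_def Let_def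
    using that
    by (intro free.subspace_sum[OF subspace_homogeneous] free.subspace_scale[OF subspace_homogeneous]) auto
  then have "free.span (antisym_reps m) \<subseteq> {v. \<forall>xs\<in>Poly_Mapping.keys v. length xs = Suc m}"
    by (intro free.span_minimal subspace_homogeneous) (auto simp: antisym_reps_def)
  then show ?thesis unfolding antisym_chains_eq tensor_power_def by (rule image_mono)
qed

lemma bar_boundary_antisym:
  assumes "v \<in> free.span (antisym_reps (Suc m))"
  shows "tensor_coset scal (linear_extension free_scale bar_boundary_basis v) \<in> antisym_chains scal \<sigma> gen (Suc m)"
proof -
  interpret L: module_hom free_scale free_scale "linear_extension free_scale bar_boundary_basis"
    by (rule module_hom_linear_extension)
  let ?S = "{w. tensor_coset scal w \<in> antisym_chains scal \<sigma> gen (Suc m)}"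
  have "free.subspace ?S"
    unfolding antisym_chains_eq
    by (intro subspace_tensor_coset_vimage tensor_subspace_image free.subspace_span)
  then have "free.subspace {v. linear_extension free_scale bar_boundary_basis v \<in> ?S}"
    by (rule L.subspace_vimage[unfolded vimage_def])
  moreover have "antisym_reps (Suc m) \<subseteq> {v. linear_extension free_scale bar_boundary_basis v \<in> ?S}"
  proof
    fix x assume "x \<in> antisym_reps (Suc m)"
    then obtain a "is" where x: "x = antisym_rep \<sigma> gen a is" "length is = Suc m"
      unfolding antisym_reps_def by blast
    from bar_boundary_antisym_rep[OF x(2)] obtain w where "w \<in> free.span (antisym_reps m)"
      "tensor_coset scal (linear_extension free_scale bar_boundary_basis x) = tensor_coset scal w"
      unfolding x(1) tensor_coset_eq_iff by blast
    then show "x \<in> {v. linear_extension free_scale bar_boundary_basis v \<in> ?S}"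
      unfolding antisym_chains_eq by simp
  qed
  ultimately have "free.span (antisym_reps (Suc m)) \<subseteq> {v. linear_extension free_scale bar_boundary_basis v \<in> ?S}"
    by (intro free.span_minimal)
  then show ?thesis using assms by blast
qed

lemma is_chain_complex_antisym_chains: "is_chain_complex scal (antisym_chains scal \<sigma> gen) (bar_boundary scal)"
proof (rule is_chain_complex_cosets)
  fix n :: nat assume "n \<ge> 1"
  then obtain m where n: "n = Suc m" by (cases n) auto
  show "antisym_chains scal \<sigma> gen n = tensor_coset scal ` free.span (antisym_reps (n - 1))"
    by (simp add: n antisym_chains_eq)
  show "tensor_coset scal (linear_extension free_scale bar_boundary_basis v) \<in> antisym_chains scal \<sigma> gen n"
    if "v \<in> free.span (antisym_reps (Suc n - 1))" for v
    using that bar_boundary_antisym by (simp add: n)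
qed (rule free.subspace_span)

end

theorem proposition4:
  fixes scal :: "'k::field \<Rightarrow> 'u::ring_1 \<Rightarrow> 'u"
    and \<sigma> :: "'k^('i::finite \<times> 'i)^('i \<times> 'i)"
    and C :: "'k^'i^('i \<times> 'i)"
    and gen :: "'i \<Rightarrow> 'u"
  assumes "quantum_lie_algebra scal \<sigma> C gen"
  shows "(\<forall>n\<ge>1. bar_boundary scal ` antisym_chains scal \<sigma> gen (n + 1)
                    \<subseteq> antisym_chains scal \<sigma> gen n) \<and>
         is_subcomplex scal (antisym_chains scal \<sigma> gen) (tensor_power scal) (bar_boundary scal)"
proof -
  interpret quantum_lie_algebra scal \<sigma> C gen by (rule assms)
  have "antisym_chains scal \<sigma> gen n \<subseteq> tensor_power scal n" if "n \<ge> 1" for n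
    using that antisym_chains_subset_tensor_power[of "n - 1"] by simp
  moreover have "bar_boundary scal ` antisym_chains scal \<sigma> gen (n + 1) \<subseteq> antisym_chains scal \<sigma> gen n"
    if "n \<ge> 1" for n
    using is_chain_complex_antisym_chains that unfolding is_chain_complex_def by blast
  ultimately show ?thesis
    unfolding is_subcomplex_def
    using is_chain_complex_antisym_chains is_chain_complex_tensor_power by blast
qed

end
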